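(* If $X$ is a proper geodesic metric space that is Gromov hyperbolic, then the Gromov boundary of $X$ equals the quasi-geodesic boundary $\partial_{QG}X$ of $X$; that is, the identity map of $X$ extends to a homeomorphism from the Gromov compactification of $X$ to the quasi-geodesic compactification $X_{QG}$, carrying the Gromov boundary onto $\partial_{QG}X$.
   Context: $Z_+$ is the set of positive integers. For $q\ge 1$, $Q\ge 0$, an integral $(q,Q)$-quasi-geodesic in a metric space $(X,d)$ is a function $g:(a,b)\cap Z_+\to X$ (the interval may be unbounded) with $\frac{|x-y|}{q}-Q\le d(g(x),g(y))\le q|x-y|+Q$ for all $x,y$ in its domain. It originates at $x_0$ if $1$ is in its domain and $g(1)=x_0$; it is a ray if its domain is $Z_+$. For $k\ge 1$, $m\ge 1$ and an integral $(k,k)$-quasi-geodesic ray $g$ with $g(1)=x_0$, the $m$-cone $C_X(x_0,k,k,g,m)$ is the set of all $x\in X$ such that $x=h(i)$ for some $i\ge m$ and some integral $(k,k)$-quasi-geodesic $h$ (possibly with finite domain) with $h(1)=x_0$ and $h(j)=g(j)$ for all $j\le m$. A function $f:X\to\mathbb{C}$ is slowly-oscillating if $|f(x_n)-f(y_n)|\to 0$ whenever $x_n\to\infty$ (i.e. $d(x_0,x_n)\to\infty$) and $d(x_n,y_n)<M$ for all $n$, for some $M>0$. A bounded continuous slowly-oscillating function $f:X\to\mathbb{C}$ is geometrically slowly-oscillating if for every $\epsilon>0$, every $k\ge1$, every $x_0\in X$ and every integral $(k,k)$-quasi-geodesic ray $g$ in $X$ originating at $x_0$ there is $m\ge 1$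 such that the diameter of $f(C_X(x_0,k,k,g,m))$ is smaller than $\epsilon$. $C_{QG}(X)$ is the $C^*$-algebra of all geometrically slowly-oscillating functions on $X$. The quasi-geodesic compactification $X_{QG}$ is the maximal ideal space of $C_{QG}(X)$ (equivalently, the compactification of $X$ such that the functions in $C_{QG}(X)$ are exactly the restrictions to $X$ of continuous functions $X_{QG}\to\mathbb{C}$). For proper $X$, the quasi-geodesic boundary is $\partial_{QG}X:=X_{QG}\setminus X$. The Gromov product is $\langle x,y\rangle_a=\frac12\big(d(x,a)+d(y,a)-d(x,y)\big)$. $X$ is Gromov hyperbolic if for some $\delta>0$, $\langle x,y\rangle_a\ge\min\{\langle x,z\rangle_a,\langle z,y\rangle_a\}-\delta/4$ for all $x,y,z,a\in X$. The Gromov compactification is $X$ together with its Gromov boundary. *)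

theory Defs
  imports "HOL-Analysis.Analysis"
begin

text \<open>Throughout, the metric space \<open>X\<close> is the universe of a type \<open>'a::metric_space\<close>.\<close>

section \<open>Proper, geodesic and Gromov hyperbolic spaces\<close>

definition proper_space :: "'a::metric_space itself \<Rightarrow> bool" where
  "proper_space _ \<longleftrightarrow> (\<forall>(x::'a) r. compact (cball x r))"

definition geodesic_space :: "'a::metric_space itself \<Rightarrow> bool" where
  "geodesic_space _ \<longleftrightarrow>
     (\<forall>x y::'a. \<exists>\<gamma>::real \<Rightarrow> 'a. \<gamma> 0 = x \<and> \<gamma> (dist x y) = y \<and>
        (\<forall>s\<in>{0..dist x y}. \<forall>t\<in>{0..dist x y}. dist (\<gamma> s) (\<gamma> t) = \<bar>s - t\<bar>))"

definition Gromov_product :: "'a::metric_space \<Rightarrow> 'a \<Rightarrow> 'a \<Rightarrow> real" where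
  "Gromov_product a x y = (dist x a + dist y a - dist x y) / 2"

definition Gromov_hyperbolic :: "'a::metric_space itself \<Rightarrow> bool" where
  "Gromov_hyperbolic _ \<longleftrightarrow>
     (\<exists>\<delta>>0. \<forall>x y z a::'a.
        Gromov_product a x y \<ge> min (Gromov_product a x z) (Gromov_product a z y) - \<delta> / 4)"

section \<open>The Gromov compactification\<close>

text \<open>
  A boundary point is an equivalence class of sequences converging to infinity. The relation below
  is an equivalence relation when the space is hyperbolic. A change of the base point \<open>a\<close> alters
  Gromov products by a bounded amount, hence affects neither the boundary nor the topology.
\<close>

definition Gromov_sequences :: "'a::metric_space \<Rightarrow> (nat \<Rightarrow> 'a) set" where
  "Gromov_sequences a =
     {u. filterlim (\<lambda>(m, n). Gromov_product a (u m) (u n)) at_top (sequentially \<times>\<^sub>F sequentially)}"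

definition Gromov_rel :: "'a::metric_space \<Rightarrow> ((nat \<Rightarrow> 'a) \<times> (nat \<Rightarrow> 'a)) set" where
  "Gromov_rel a =
     {(u, v). u \<in> Gromov_sequences a \<and> v \<in> Gromov_sequences a \<and>
        filterlim (\<lambda>(m, n). Gromov_product a (u m) (v n)) at_top (sequentially \<times>\<^sub>F sequentially)}"

definition Gromov_boundary :: "'a::metric_space \<Rightarrow> (nat \<Rightarrow> 'a) set set" where
  "Gromov_boundary a = Gromov_sequences a // Gromov_rel a"

text \<open>\<open>Inl x\<close> is the point \<open>x\<close> of the space, \<open>Inr \<xi>\<close> the boundary point \<open>\<xi>\<close>.\<close>

type_synonym 'a Gromov_point = "'a + (nat \<Rightarrow> 'a) set"

definition Gromov_points :: "'a::metric_space \<Rightarrow> 'a Gromov_point set" where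
  "Gromov_points a = range Inl \<union> Inr ` Gromov_boundary a"

fun representing_sequences :: "'a::metric_space Gromov_point \<Rightarrow> (nat \<Rightarrow> 'a) set" where
  "representing_sequences (Inl x) = {u. u \<longlonglongrightarrow> x}"
| "representing_sequences (Inr \<xi>) = \<xi>"

text \<open>
  The usual extension of the Gromov product: the supremum, over sequences \<open>u\<close>, \<open>v\<close> converging to
  the two points, of the lower limit of the Gromov products of \<open>u m\<close> and \<open>v n\<close> as both
  indices tend to infinity.
\<close>

definition extended_Gromov_product ::
    "'a::metric_space \<Rightarrow> 'a Gromov_point \<Rightarrow> 'a Gromov_point \<Rightarrow> ereal" where
  "extended_Gromov_product a z w =
     (SUP (u, v) \<in> representing_sequences z \<times> representing_sequences w.
        Liminf (sequentially \<times>\<^sub>F sequentially) (\<lambda>(m, n). ereal (Gromov_product a (u m) (v n))))"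

text \<open>
  The topology in which points of the space keep their metric neighbourhoods and the sets
  \<open>{z. extended_Gromov_product a (Inr \<xi>) z > r}\<close> are basic neighbourhoods of \<open>\<xi>\<close>.
\<close>

definition Gromov_open :: "'a::metric_space \<Rightarrow> 'a Gromov_point set \<Rightarrow> bool" where
  "Gromov_open a U \<longleftrightarrow>
     U \<subseteq> Gromov_points a \<and> open {x. Inl x \<in> U} \<and>
     (\<forall>\<xi>. Inr \<xi> \<in> U \<longrightarrow>
        (\<exists>r::real. {z \<in> Gromov_points a. extended_Gromov_product a (Inr \<xi>) z > ereal r} \<subseteq> U))"

definition Gromov_compactification :: "'a::metric_space \<Rightarrow> 'a Gromov_point topology" where
  "Gromov_compactification a = topology (Gromov_open a)"

lemma istopology_Gromov_open: "istopology (Gromov_open a)"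
  unfolding istopology_def
proof (intro conjI allI impI)
  fix S T assume S: "Gromov_open a S" and T: "Gromov_open a T"
  let ?N = "\<lambda>\<xi> r. {z \<in> Gromov_points a. extended_Gromov_product a (Inr \<xi>) z > ereal r}"
  have "\<exists>r. ?N \<xi> r \<subseteq> S \<inter> T" if xi: "Inr \<xi> \<in> S \<inter> T" for \<xi>
  proof -
    obtain r s where "?N \<xi> r \<subseteq> S" "?N \<xi> s \<subseteq> T"
      using S T xi unfolding Gromov_open_def by blast
    moreover have "?N \<xi> (max r s) \<subseteq> ?N \<xi> r \<inter> ?N \<xi> s"
      by (auto elim!: le_less_trans[rotated])
    ultimately show ?thesis by blast
  qed
  moreover have "{x. Inl x \<in> S \<inter> T} = {x. Inl x \<in> S} \<inter> {x. Inl x \<in> T}" by auto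
  ultimately show "Gromov_open a (S \<inter> T)"
    using S T unfolding Gromov_open_def by (auto intro: open_Int)
next
  fix K assume K: "\<forall>U\<in>K. Gromov_open a U"
  have "{x. Inl x \<in> \<Union>K} = (\<Union>U\<in>K. {x. Inl x \<in> U})" by auto
  moreover have "open (\<Union>U\<in>K. {x. Inl x \<in> U})"
    using K unfolding Gromov_open_def by blast
  ultimately have "open {x. Inl x \<in> \<Union>K}" by simp
  moreover have "\<Union>K \<subseteq> Gromov_points a"
    using K unfolding Gromov_open_def by blast
  moreover have "\<exists>r::real. {z \<in> Gromov_points a. extended_Gromov_product a (Inr \<xi>) z > ereal r} \<subseteq> \<Union>K"
    if "Inr \<xi> \<in> \<Union>K" for \<xi>
    using K that unfolding Gromov_open_def by (meson UnionE Union_upper subset_trans)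
  ultimately show "Gromov_open a (\<Union>K)"
    unfolding Gromov_open_def by blast
qed

lemma openin_Gromov_compactification:
  "openin (Gromov_compactification a) U \<longleftrightarrow> Gromov_open a U"
  by (simp add: Gromov_compactification_def istopology_Gromov_open topology_inverse')

lemma topspace_Gromov_compactification:
  "topspace (Gromov_compactification a) = Gromov_points a"
proof -
  have "{x. Inl x \<in> Gromov_points a} = UNIV"
    by (auto simp: Gromov_points_def)
  then have "Gromov_open a (Gromov_points a)"
    unfolding Gromov_open_def by auto
  then show ?thesis
    unfolding topspace_def openin_Gromov_compactification by (auto simp: Gromov_open_def)
qed

section \<open>Integral quasi-geodesics and cones\<close>

text \<open>
  Integral quasi-geodesics are total functions \<open>g\<close> together with their domain \<open>D\<close>, the trace of an
  open, possibly unbounded, interval on the positive integers; values off \<open>D\<close> are irrelevant.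
\<close>

definition integral_quasi_geodesic ::
    "real \<Rightarrow> real \<Rightarrow> nat set \<Rightarrow> (nat \<Rightarrow> 'a::metric_space) \<Rightarrow> bool" where
  "integral_quasi_geodesic q Q D g \<longleftrightarrow>
     q \<ge> 1 \<and> Q \<ge> 0 \<and>
     (\<exists>a b::ereal. D = {n. n \<ge> 1 \<and> a < ereal (real n) \<and> ereal (real n) < b}) \<and>
     (\<forall>x\<in>D. \<forall>y\<in>D. \<bar>real x - real y\<bar> / q - Q \<le> dist (g x) (g y) \<and>
                     dist (g x) (g y) \<le> q * \<bar>real x - real y\<bar> + Q)"

definition originates_at :: "nat set \<Rightarrow> (nat \<Rightarrow> 'a) \<Rightarrow> 'a \<Rightarrow> bool" where
  "originates_at D g x0 \<longleftrightarrow> 1 \<in> D \<and> g 1 = x0"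

definition integral_quasi_geodesic_ray ::
    "real \<Rightarrow> real \<Rightarrow> (nat \<Rightarrow> 'a::metric_space) \<Rightarrow> bool" where
  "integral_quasi_geodesic_ray q Q g \<longleftrightarrow> integral_quasi_geodesic q Q {1..} g"

text \<open>
  As \<open>D\<close> is an interval containing \<open>1\<close> and some \<open>i \<ge> m\<close>, it contains all \<open>j \<in> {1..m}\<close>.
\<close>

definition QG_cone ::
    "'a::metric_space \<Rightarrow> real \<Rightarrow> real \<Rightarrow> (nat \<Rightarrow> 'a) \<Rightarrow> nat \<Rightarrow> 'a set" where
  "QG_cone x0 q Q g m =
     {x. \<exists>D h i. integral_quasi_geodesic q Q D h \<and> originates_at D h x0 \<and>
                 i \<in> D \<and> i \<ge> m \<and> x = h i \<and> (\<forall>j\<in>{1..m}. h j = g j)}"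

section \<open>Geometrically slowly-oscillating functions\<close>

definition slowly_oscillating :: "('a::metric_space \<Rightarrow> complex) \<Rightarrow> bool" where
  "slowly_oscillating f \<longleftrightarrow>
     (\<forall>x0 x y M. M > 0 \<and> filterlim (\<lambda>n. dist x0 (x n)) at_top sequentially \<and>
        (\<forall>n. dist (x n) (y n) < M) \<longrightarrow> (\<lambda>n. cmod (f (x n) - f (y n))) \<longlonglongrightarrow> 0)"

definition geometrically_slowly_oscillating :: "('a::metric_space \<Rightarrow> complex) \<Rightarrow> bool" where
  "geometrically_slowly_oscillating f \<longleftrightarrow>
     bounded (range f) \<and> continuous_on UNIV f \<and> slowly_oscillating f \<and>
     (\<forall>\<epsilon>>0. \<forall>k\<ge>1. \<forall>x0 g. integral_quasi_geodesic_ray k k g \<and> originates_at {1..} g x0 \<longrightarrow>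
        (\<exists>m\<ge>1. diameter (f ` QG_cone x0 k k g m) < \<epsilon>))"

definition C_QG :: "('a::metric_space \<Rightarrow> complex) set" where
  "C_QG = {f. geometrically_slowly_oscillating f}"

section \<open>The quasi-geodesic compactification\<close>

text \<open>
  The maximal ideal space of an algebra \<open>A\<close> of complex functions (with pointwise operations) in its
  usual form: the nonzero multiplicative linear functionals with the topology of pointwise
  convergence, that is, the Gelfand or weak-* topology; a functional corresponds to the maximal
  ideal which is its kernel. Functionals are functions on \<open>A\<close>, so they are taken to be extensional.
\<close>

definition characters :: "('a \<Rightarrow> complex) set \<Rightarrow> (('a \<Rightarrow> complex) \<Rightarrow> complex) set" where
  "characters A =
     {\<phi> \<in> extensional A.
        (\<forall>f\<in>A. \<forall>g\<in>A. \<phi> (\<lambda>x. f x + g x) = \<phi> f + \<phi> g) \<and>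
        (\<forall>c. \<forall>f\<in>A. \<phi> (\<lambda>x. c * f x) = c * \<phi> f) \<and>
        (\<forall>f\<in>A. \<forall>g\<in>A. \<phi> (\<lambda>x. f x * g x) = \<phi> f * \<phi> g) \<and>
        (\<exists>f\<in>A. \<phi> f \<noteq> 0)}"

definition maximal_ideal_space ::
    "('a \<Rightarrow> complex) set \<Rightarrow> (('a \<Rightarrow> complex) \<Rightarrow> complex) topology" where
  "maximal_ideal_space A = subtopology (product_topology (\<lambda>_. euclidean) A) (characters A)"

definition QG_compactification :: "(('a::metric_space \<Rightarrow> complex) \<Rightarrow> complex) topology" where
  "QG_compactification = maximal_ideal_space C_QG"

text \<open>The canonical map of the space into its compactification: evaluation at a point.\<close>

definition QG_embedding :: "'a::metric_space \<Rightarrow> (('a \<Rightarrow> complex) \<Rightarrow> complex)" where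
  "QG_embedding x = (\<lambda>f\<in>C_QG. f x)"

definition QG_boundary :: "(('a::metric_space \<Rightarrow> complex) \<Rightarrow> complex) set" where
  "QG_boundary = topspace QG_compactification - range QG_embedding"

end

theory Submission
  imports Defs
begin

text \<open>
  Evaluating the continuous extension of a function at a point of the Gromov compactification gives
  a character of the algebra of geometrically slowly-oscillating functions. This map is the
  homeomorphism, and three facts make it one.

  \<^item> Functions of the algebra extend continuously to the Gromov boundary
    (\<open>C_QG_small_near_boundary\<close>). If \<open>x\<close> is close to a boundary point \<open>\<xi>\<close>, then a geodesic from the
    base point to \<open>x\<close> follows a quasi-geodesic ray towards \<open>\<xi>\<close> for a long time. Hence \<open>x\<close> lies in a
    deep cone of that ray, where the function is almost constant.

  \<^item> Conversely, a bounded continuous function which oscillates little between points with a large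
    Gromov product belongs to the algebra (\<open>C_QG_criterion\<close>), because any two points of a deep cone
    have a large Gromov product. The distance to a point in Frink's chain metric built from the
    quasi-metric \<open>exp (- \<epsilon> * Gromov_product a x y)\<close> is such a function, up to a harmless
    modification which makes it continuous. These functions and bump functions separate points.

  \<^item> The Gromov compactification is compact (\<open>compact_space_Gromov_compactification\<close>), by Koenig's
    lemma for the shadows of finite nets in balls of growing radius.

  Compactness and closure of the algebra under conjugation and under inversion of functions bounded
  away from \<open>0\<close> make every character an evaluation (\<open>character_is_evaluation\<close>). So evaluation is a
  continuous bijection from a compact space to a Hausdorff space.
\<close>

section \<open>Gromov products\<close>

lemma Gromov_product_commute: "Gromov_product b x y = Gromov_product b y x"
  by (simp add: Gromov_product_def dist_commute)

lemma Gromov_product_le_dist_left: "Gromov_product b x y \<le> dist x b"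
  unfolding Gromov_product_def using dist_triangle[of y b x] by (simp add: dist_commute)

lemma Gromov_product_le_dist_right: "Gromov_product b x y \<le> dist y b"
  using Gromov_product_le_dist_left[of b y x] by (simp add: Gromov_product_commute)

lemma Gromov_product_nonneg: "0 \<le> Gromov_product b x y"
  unfolding Gromov_product_def using dist_triangle[of x y b] by (simp add: dist_commute)

lemma Gromov_product_ge_dist: "dist x b - dist x y \<le> Gromov_product b x y"
  unfolding Gromov_product_def using dist_triangle[of x b y] by (simp add: dist_commute)

lemma Gromov_product_lipschitz_left: "Gromov_product b x z \<le> Gromov_product b y z + dist x y"
  unfolding Gromov_product_def
  using dist_triangle[of x b y] dist_triangle[of y z x] by (simp add: dist_commute field_simps)

lemma Gromov_product_change_base: "Gromov_product b x y \<le> Gromov_product c x y + dist b c"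
  unfolding Gromov_product_def
  using dist_triangle[of x b c] dist_triangle[of y b c] by (simp add: dist_commute field_simps)

lemma filterlim_Gromov_product_iff:
  "filterlim (\<lambda>(m, n). Gromov_product a (u m) (v n)) at_top (sequentially \<times>\<^sub>F sequentially) \<longleftrightarrow>
   (\<forall>R. \<exists>N. \<forall>m\<ge>N. \<forall>n\<ge>N. R \<le> Gromov_product a (u m) (v n))"
  unfolding filterlim_at_top eventually_prod_sequentially by auto blast+

lemma Gromov_sequenceD:
  assumes "u \<in> Gromov_sequences a"
  obtains N where "\<And>m n. N \<le> m \<Longrightarrow> N \<le> n \<Longrightarrow> R \<le> Gromov_product a (u m) (u n)"
  using assms unfolding Gromov_sequences_def mem_Collect_eq filterlim_Gromov_product_iff by meson

lemma Gromov_sequenceI: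
  assumes "\<And>R. \<exists>N. \<forall>m\<ge>N. \<forall>n\<ge>N. R \<le> Gromov_product a (u m) (u n)"
  shows "u \<in> Gromov_sequences a"
  using assms unfolding Gromov_sequences_def mem_Collect_eq filterlim_Gromov_product_iff by blast

lemma Gromov_rel_iff:
  "(u, v) \<in> Gromov_rel a \<longleftrightarrow> u \<in> Gromov_sequences a \<and> v \<in> Gromov_sequences a \<and>
     (\<forall>R. \<exists>N. \<forall>m\<ge>N. \<forall>n\<ge>N. R \<le> Gromov_product a (u m) (v n))"
  unfolding Gromov_rel_def by (simp add: filterlim_Gromov_product_iff)

lemma Gromov_relD:
  assumes "(u, v) \<in> Gromov_rel a"
  obtains N where "\<And>m n. N \<le> m \<Longrightarrow> N \<le> n \<Longrightarrow> R \<le> Gromov_product a (u m) (v n)"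
  using assms unfolding Gromov_rel_iff by meson

section \<open>Hyperbolic spaces and their boundary points\<close>

text \<open>
  Here \<open>\<delta>\<close> is one quarter of the constant in the definition of hyperbolicity, so that every use of
  the four-point condition loses \<open>\<delta>\<close>.
\<close>

locale hyperbolic_space =
  fixes a :: "'a::metric_space" and \<delta> :: real
  assumes delta_pos: "\<delta> > 0"
    and hyperbolic:
      "min (Gromov_product b x z) (Gromov_product b z y) - \<delta> \<le> Gromov_product b x (y::'a)"
begin

lemma hyperbolic_trans:
  assumes "R \<le> Gromov_product b x z" "R \<le> Gromov_product b z (y::'a)"
  shows "R - \<delta> \<le> Gromov_product b x y"
  using hyperbolic[of b x z y] assms by linarith

lemma hyperbolic_trans2:
  assumes "R \<le> Gromov_product b x z" "R \<le> Gromov_product b z w" "R \<le> Gromov_product b w (y::'a)"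
  shows "R - 2 * \<delta> \<le> Gromov_product b x y"
  using hyperbolic[of b x z y] hyperbolic[of b z w y] assms delta_pos by linarith

lemma equiv_Gromov_rel: "equiv (Gromov_sequences a) (Gromov_rel a)"
proof (rule equivI)
  show "Gromov_rel a \<subseteq> Gromov_sequences a \<times> Gromov_sequences a"
    unfolding Gromov_rel_def by blast
  show "refl_on (Gromov_sequences a) (Gromov_rel a)"
    unfolding refl_on_def Gromov_rel_def Gromov_sequences_def by blast
  show "sym (Gromov_rel a)"
    unfolding sym_def Gromov_rel_iff by (metis Gromov_product_commute)
  show "trans (Gromov_rel a)"
  proof (rule transI)
    fix u v w assume uv: "(u, v) \<in> Gromov_rel a" and vw: "(v, w) \<in> Gromov_rel a"
    have "\<exists>N. \<forall>m\<ge>N. \<forall>n\<ge>N. R \<le> Gromov_product a (u m) (w n)" for R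
    proof -
      obtain N where N: "\<And>m n. N \<le> m \<Longrightarrow> N \<le> n \<Longrightarrow> R + \<delta> \<le> Gromov_product a (u m) (v n)"
        using Gromov_relD[OF uv] by blast
      obtain M where M: "\<And>m n. M \<le> m \<Longrightarrow> M \<le> n \<Longrightarrow> R + \<delta> \<le> Gromov_product a (v m) (w n)"
        using Gromov_relD[OF vw] by blast
      have "R \<le> Gromov_product a (u m) (w n)" if "max N M \<le> m" "max N M \<le> n" for m n
        using hyperbolic_trans[of "R + \<delta>" a "u m" "v m" "w n"] N[of m m] M[of m n] that by simp
      then show ?thesis by blast
    qed
    then show "(u, w) \<in> Gromov_rel a"
      using uv vw unfolding Gromov_rel_iff by blast
  qed
qed

lemma boundary_rel:
  assumes "\<xi> \<in> Gromov_boundary a" "u \<in> \<xi>" "v \<in> \<xi>"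
  shows "(u, v) \<in> Gromov_rel a"
  using assms equiv_Gromov_rel unfolding Gromov_boundary_def by (metis quotient_eq_iff)

lemma boundary_sequence:
  assumes "\<xi> \<in> Gromov_boundary a" "u \<in> \<xi>"
  shows "u \<in> Gromov_sequences a"
  using boundary_rel[OF assms assms(2)] by (simp add: Gromov_rel_iff)

lemma boundary_nonempty:
  assumes "\<xi> \<in> Gromov_boundary a"
  obtains u where "u \<in> \<xi>"
  using assms equiv_Gromov_rel unfolding Gromov_boundary_def
  by (metis ex_in_conv in_quotient_imp_non_empty)

lemma boundary_class:
  assumes "u \<in> Gromov_sequences a"
  obtains \<xi> where "\<xi> \<in> Gromov_boundary a" "u \<in> \<xi>"
  using assms equiv_Gromov_rel unfolding Gromov_boundary_def
  by (metis equiv_class_self quotientI)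

lemma boundary_distinct_not_rel:
  assumes "\<xi> \<in> Gromov_boundary a" "\<eta> \<in> Gromov_boundary a" "\<xi> \<noteq> \<eta>" "u \<in> \<xi>" "v \<in> \<eta>"
  shows "(u, v) \<notin> Gromov_rel a"
  using assms equiv_Gromov_rel unfolding Gromov_boundary_def by (metis quotient_eqI)

text \<open>
  The extended product is a supremum over all representing sequences of both points. By hyperbolicity
  the sequence \<open>u\<close> may nevertheless be fixed in advance, at the cost of \<open>\<delta>\<close>.
\<close>

lemma extended_product_gtD:
  assumes xi: "\<xi> \<in> Gromov_boundary a" and u: "u \<in> \<xi>"
    and gt: "ereal (R + \<delta>) < extended_Gromov_product a (Inr \<xi>) z"
  obtains v N where "v \<in> representing_sequences z"
    "\<And>m n. N \<le> m \<Longrightarrow> N \<le> n \<Longrightarrow> R \<le> Gromov_product a (u m) (v n)"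
proof -
  from gt obtain u' v where u': "u' \<in> \<xi>" and v: "v \<in> representing_sequences z"
    and lim: "ereal (R + \<delta>) < Liminf (sequentially \<times>\<^sub>F sequentially)
                                    (\<lambda>(m, n). ereal (Gromov_product a (u' m) (v n)))"
    unfolding extended_Gromov_product_def less_SUP_iff by auto
  obtain N where N: "\<And>m n. N \<le> m \<Longrightarrow> N \<le> n \<Longrightarrow> R + \<delta> \<le> Gromov_product a (u' m) (v n)"
    using less_LiminfD[OF lim] unfolding eventually_prod_sequentially by (auto intro: less_imp_le)
  obtain M where M: "\<And>m n. M \<le> m \<Longrightarrow> M \<le> n \<Longrightarrow> R + \<delta> \<le> Gromov_product a (u m) (u' n)"
    using Gromov_relD[OF boundary_rel[OF xi u u']] by blast
  have "R \<le> Gromov_product a (u m) (v n)" if "max N M \<le> m" "max N M \<le> n" for m n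
    using hyperbolic_trans[of "R + \<delta>" a "u m" "u' m" "v n"] N[of m n] M[of m m] that by simp
  with v show ?thesis using that by blast
qed

lemma extended_product_ge:
  assumes "u \<in> representing_sequences z" "v \<in> representing_sequences w"
    and "\<And>m n. N \<le> m \<Longrightarrow> N \<le> n \<Longrightarrow> R \<le> Gromov_product a (u m) (v n)"
  shows "ereal R \<le> extended_Gromov_product a z w"
proof -
  have "ereal R \<le> Liminf (sequentially \<times>\<^sub>F sequentially)
                     (\<lambda>(m, n). ereal (Gromov_product a (u m) (v n)))"
    by (rule Liminf_bounded) (use assms(3) in \<open>auto simp: eventually_prod_sequentially\<close>)
  also have "\<dots> \<le> extended_Gromov_product a z w"
    unfolding extended_Gromov_product_def
    by (rule SUP_upper2[where i = "(u, v)"]) (use assms in auto)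
  finally show ?thesis .
qed

end

section \<open>The algebra of geometrically slowly-oscillating functions\<close>

lemma diameter_image_less_iff_exists:
  fixes f :: "'a \<Rightarrow> complex"
  assumes bd: "bounded (range f)"
  shows "(\<forall>e>0. \<exists>m\<ge>1. diameter (f ` S m) < e) \<longleftrightarrow>
         (\<forall>e>0. \<exists>m\<ge>(1::nat). \<forall>x\<in>S m. \<forall>y\<in>S m. norm (f x - f y) < e)"
proof (intro iffI allI impI)
  fix e :: real
  assume "\<forall>e>0. \<exists>m\<ge>1. diameter (f ` S m) < e" "0 < e"
  then obtain m where m: "m \<ge> 1" "diameter (f ` S m) < e" by blast
  have "norm (f x - f y) < e" if "x \<in> S m" "y \<in> S m" for x y
    using diameter_bounded_bound[of "f ` S m" "f x" "f y"] bounded_subset[OF bd, of "f ` S m"] that m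
    by (auto simp: dist_norm image_mono)
  with m show "\<exists>m\<ge>1. \<forall>x\<in>S m. \<forall>y\<in>S m. norm (f x - f y) < e" by blast
next
  fix e :: real
  assume *: "\<forall>e>0. \<exists>m\<ge>1. \<forall>x\<in>S m. \<forall>y\<in>S m. norm (f x - f y) < e" and e: "0 < e"
  then obtain m where m: "m \<ge> 1" "\<forall>x\<in>S m. \<forall>y\<in>S m. norm (f x - f y) < e / 2"
    by (meson half_gt_zero)
  have "diameter (f ` S m) \<le> e / 2"
    by (rule diameter_le) (use m e in \<open>auto intro: less_imp_le\<close>)
  with m e show "\<exists>m\<ge>1. diameter (f ` S m) < e" by force
qed

text \<open>
  The cone condition in terms of pairs of points. It is equivalent only when all \<open>\<epsilon>\<close> are considered
  together, since a strict bound for all distances need not be a strict bound for the diameter.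
\<close>

lemma C_QG_iff:
  "f \<in> C_QG \<longleftrightarrow> bounded (range f) \<and> continuous_on UNIV f \<and> slowly_oscillating f \<and>
     (\<forall>k\<ge>1. \<forall>x0 g. integral_quasi_geodesic_ray k k g \<and> originates_at {1..} g x0 \<longrightarrow>
        (\<forall>e>0. \<exists>m\<ge>1. \<forall>x\<in>QG_cone x0 k k g m. \<forall>y\<in>QG_cone x0 k k g m. cmod (f x - f y) < e))"
  (is "_ \<longleftrightarrow> ?bd \<and> ?cont \<and> ?slow \<and> ?cones")
proof -
  have "(\<forall>e>0. \<forall>k\<ge>1. \<forall>x0 g. integral_quasi_geodesic_ray k k g \<and> originates_at {1..} g x0 \<longrightarrow>
          (\<exists>m\<ge>1. diameter (f ` QG_cone x0 k k g m) < e)) \<longleftrightarrow> ?cones" if ?bd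
  proof -
    note eq = diameter_image_less_iff_exists[OF that, of "QG_cone x0 k k g" for x0 k g]
    show ?thesis unfolding eq[symmetric] by blast
  qed
  then show ?thesis
    unfolding C_QG_def geometrically_slowly_oscillating_def mem_Collect_eq by blast
qed

lemma C_QG_bounded: "f \<in> C_QG \<Longrightarrow> \<exists>B. \<forall>x. cmod (f x) \<le> B"
proof -
  assume "f \<in> C_QG"
  then have "bounded (range f)" unfolding C_QG_iff by blast
  then show ?thesis by (simp add: bounded_iff)
qed

lemma C_QG_isCont: "f \<in> C_QG \<Longrightarrow> isCont f x"
proof -
  assume "f \<in> C_QG"
  then have "continuous_on UNIV f" unfolding C_QG_iff by blast
  then show "isCont f x" by (simp add: continuous_on_eq_continuous_at)
qed

lemma C_QG_slowly_oscillating: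
  assumes "f \<in> C_QG"
    and "M > 0 \<and> filterlim (\<lambda>n. dist x0 (x n)) at_top sequentially \<and> (\<forall>n. dist (x n) (y n) < M)"
  shows "(\<lambda>n. cmod (f (x n) - f (y n))) \<longlonglongrightarrow> 0"
proof -
  have "slowly_oscillating f" using assms(1) unfolding C_QG_iff by blast
  then show ?thesis using assms(2) unfolding slowly_oscillating_def by metis
qed

lemma QG_cone_antimono: "m \<le> n \<Longrightarrow> QG_cone x0 q Q g n \<subseteq> QG_cone x0 q Q g m"
proof
  fix x assume "m \<le> n" "x \<in> QG_cone x0 q Q g n"
  then obtain D h i where "integral_quasi_geodesic q Q D h" "originates_at D h x0"
    "i \<in> D" "n \<le> i" "x = h i" "\<forall>j\<in>{1..n}. h j = g j"
    unfolding QG_cone_def by blast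
  moreover from this(4,6) have "m \<le> i" "\<forall>j\<in>{1..m}. h j = g j" using \<open>m \<le> n\<close> by auto
  ultimately show "x \<in> QG_cone x0 q Q g m"
    unfolding QG_cone_def by blast
qed

lemma C_QG_cone:
  assumes "f \<in> C_QG" "k \<ge> 1" "integral_quasi_geodesic_ray k k g" "originates_at {1..} g x0" "e > 0"
  obtains m where "m \<ge> 1"
    "\<And>x y. x \<in> QG_cone x0 k k g m \<Longrightarrow> y \<in> QG_cone x0 k k g m \<Longrightarrow> cmod (f x - f y) < e"
  using assms unfolding C_QG_iff by meson

text \<open>
  All defining conditions bound oscillations, so they pass to any function whose oscillation is
  dominated by those of members of the algebra. Sums, products, conjugates and inverses of
  functions bounded away from \<open>0\<close> are all of this form.
\<close>

lemma C_QG_dominated: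
  fixes h :: "'a::metric_space \<Rightarrow> complex"
  assumes f: "f \<in> C_QG" and g: "g \<in> C_QG"
    and dom: "\<And>x y. cmod (h x - h y) \<le> K * (cmod (f x - f y) + cmod (g x - g y))"
  shows "h \<in> C_QG"
proof -
  define B where "B = max K 1"
  have B: "B > 0" "cmod (h x - h y) \<le> B * (cmod (f x - f y) + cmod (g x - g y))" for x y
  proof -
    have "K * (cmod (f x - f y) + cmod (g x - g y)) \<le> B * (cmod (f x - f y) + cmod (g x - g y))"
      by (rule mult_right_mono) (simp_all add: B_def)
    then show "cmod (h x - h y) \<le> B * (cmod (f x - f y) + cmod (g x - g y))"
      using dom[of x y] by linarith
  qed (simp add: B_def)
  have small: "cmod (h x - h y) < e"
    if "cmod (f x - f y) < e / (2 * B)" "cmod (g x - g y) < e / (2 * B)" for x y e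
  proof -
    have "B * (cmod (f x - f y) + cmod (g x - g y)) < B * (e / (2 * B) + e / (2 * B))"
      by (rule mult_strict_left_mono[OF add_strict_mono[OF that] B(1)])
    also have "\<dots> = e" using B(1) by (simp add: field_simps)
    finally show ?thesis using B(2)[of x y] by linarith
  qed
  have "bounded (range h)"
  proof -
    obtain Mf where Mf: "\<And>x. cmod (f x) \<le> Mf" using C_QG_bounded[OF f] by auto
    obtain Mg where Mg: "\<And>x. cmod (g x) \<le> Mg" using C_QG_bounded[OF g] by auto
    note M = Mf Mg
    have "cmod (h x) \<le> cmod (h undefined) + B * (2 * Mf + 2 * Mg)" for x
    proof -
      have "cmod (f x - f undefined) \<le> 2 * Mf" "cmod (g x - g undefined) \<le> 2 * Mg"
        using norm_triangle_ineq4[of "f x" "f undefined"] norm_triangle_ineq4[of "g x" "g undefined"]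
          M(1)[of x] M(1)[of undefined] M(2)[of x] M(2)[of undefined] by linarith+
      then have "B * (cmod (f x - f undefined) + cmod (g x - g undefined)) \<le> B * (2 * Mf + 2 * Mg)"
        using B(1) by (intro mult_left_mono add_mono) auto
      then show ?thesis
        using B(2)[of x undefined] norm_triangle_sub[of "h x" "h undefined"] by linarith
    qed
    then show ?thesis unfolding bounded_iff by blast
  qed
  moreover have "continuous_on UNIV h"
  proof -
    have "isCont h x" for x
    proof -
      have "(f \<longlongrightarrow> f x) (at x)" "(g \<longlongrightarrow> g x) (at x)"
        using C_QG_isCont f g unfolding isCont_def by blast+
      then have "((\<lambda>y. B * (cmod (f y - f x) + cmod (g y - g x))) \<longlongrightarrow>
                 B * (cmod (f x - f x) + cmod (g x - g x))) (at x)"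
        by (intro tendsto_intros)
      then have "((\<lambda>y. h y - h x) \<longlongrightarrow> 0) (at x)"
        by (intro Lim_null_comparison[OF always_eventually[OF allI[OF B(2)]]]) simp
      then show ?thesis by (simp add: isCont_def LIM_zero_iff)
    qed
    then show ?thesis by (simp add: continuous_on_eq_continuous_at)
  qed
  moreover have "slowly_oscillating h"
    unfolding slowly_oscillating_def
  proof (intro allI impI)
    fix x0 :: 'a and x y :: "nat \<Rightarrow> 'a" and M
    assume *: "M > 0 \<and> filterlim (\<lambda>n. dist x0 (x n)) at_top sequentially \<and> (\<forall>n. dist (x n) (y n) < M)"
    have "(\<lambda>n. cmod (f (x n) - f (y n))) \<longlonglongrightarrow> 0" "(\<lambda>n. cmod (g (x n) - g (y n))) \<longlonglongrightarrow> 0"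
      using C_QG_slowly_oscillating[OF f *] C_QG_slowly_oscillating[OF g *] by blast+
    then have "(\<lambda>n. B * (cmod (f (x n) - f (y n)) + cmod (g (x n) - g (y n)))) \<longlonglongrightarrow> B * (0 + 0)"
      by (intro tendsto_intros)
    then have "(\<lambda>n. h (x n) - h (y n)) \<longlonglongrightarrow> 0"
      by (intro Lim_null_comparison[OF always_eventually[OF allI[OF B(2)]]]) simp
    then show "(\<lambda>n. cmod (h (x n) - h (y n))) \<longlonglongrightarrow> 0" by (rule tendsto_norm_zero)
  qed
  moreover have "\<exists>m\<ge>1. \<forall>x\<in>QG_cone x0 k k u m. \<forall>y\<in>QG_cone x0 k k u m. cmod (h x - h y) < e"
    if k: "k \<ge> 1" and u: "integral_quasi_geodesic_ray k k u" "originates_at {1..} u x0" and e: "e > 0"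
    for k e and x0 :: 'a and u
  proof -
    have e': "e / (2 * B) > 0" using e B(1) by simp
    obtain m where m: "m \<ge> 1" "\<And>x y. x \<in> QG_cone x0 k k u m \<Longrightarrow> y \<in> QG_cone x0 k k u m
        \<Longrightarrow> cmod (f x - f y) < e / (2 * B)"
      using C_QG_cone[OF f k u e'] by blast
    obtain n where n: "n \<ge> 1" "\<And>x y. x \<in> QG_cone x0 k k u n \<Longrightarrow> y \<in> QG_cone x0 k k u n
        \<Longrightarrow> cmod (g x - g y) < e / (2 * B)"
      using C_QG_cone[OF g k u e'] by blast
    have "QG_cone x0 k k u (max m n) \<subseteq> QG_cone x0 k k u m"
         "QG_cone x0 k k u (max m n) \<subseteq> QG_cone x0 k k u n"
      by (rule QG_cone_antimono; simp)+
    then have "cmod (h x - h y) < e"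
      if "x \<in> QG_cone x0 k k u (max m n)" "y \<in> QG_cone x0 k k u (max m n)" for x y
      by (intro small m(2) n(2)) (use that in auto)
    then show ?thesis using m(1) by (intro exI[of _ "max m n"]) auto
  qed
  ultimately show ?thesis unfolding C_QG_iff by blast
qed

lemma C_QG_const: "(\<lambda>_. c) \<in> C_QG"
proof -
  have "slowly_oscillating (\<lambda>_. c)" by (simp add: slowly_oscillating_def)
  moreover have "\<exists>m\<ge>1. \<forall>x\<in>S m. \<forall>y\<in>S m. cmod (c - c) < e" if "e > 0" for e and S :: "nat \<Rightarrow> 'b set"
    using that by (intro exI[of _ 1]) simp
  moreover have "bounded (range (\<lambda>_. c))" "continuous_on UNIV (\<lambda>_. c)" by simp_all
  ultimately show ?thesis unfolding C_QG_iff by blast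
qed

lemma C_QG_add:
  assumes "f \<in> C_QG" "g \<in> C_QG"
  shows "(\<lambda>x. f x + g x) \<in> C_QG"
proof (rule C_QG_dominated[OF assms])
  show "cmod (f x + g x - (f y + g y)) \<le> 1 * (cmod (f x - f y) + cmod (g x - g y))" for x y
    using norm_triangle_ineq[of "f x - f y" "g x - g y"] by (simp add: algebra_simps)
qed

lemma C_QG_mult:
  assumes f: "f \<in> C_QG" and g: "g \<in> C_QG"
  shows "(\<lambda>x. f x * g x) \<in> C_QG"
proof -
  obtain Mf where Mf: "\<And>x. cmod (f x) \<le> Mf" using C_QG_bounded[OF f] by auto
  obtain Mg where Mg: "\<And>x. cmod (g x) \<le> Mg" using C_QG_bounded[OF g] by auto
  note M = Mf Mg
  have "cmod (f x * g x - f y * g y) \<le> max Mf Mg * (cmod (f x - f y) + cmod (g x - g y))" for x y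
  proof -
    have "cmod (f x * g x - f y * g y) = cmod (g x * (f x - f y) + f y * (g x - g y))"
      by (simp add: algebra_simps)
    also have "\<dots> \<le> cmod (g x) * cmod (f x - f y) + cmod (f y) * cmod (g x - g y)"
      by (metis norm_mult norm_triangle_ineq)
    also have "\<dots> \<le> max Mf Mg * cmod (f x - f y) + max Mf Mg * cmod (g x - g y)"
      using M(2)[of x] M(1)[of y] by (intro add_mono mult_right_mono) auto
    finally show ?thesis by (simp add: algebra_simps)
  qed
  then show ?thesis by (rule C_QG_dominated[OF f g])
qed

lemma C_QG_cnj: "f \<in> C_QG \<Longrightarrow> (\<lambda>x. cnj (f x)) \<in> C_QG"
  by (rule C_QG_dominated[of f f _ 1]) (simp_all flip: complex_cnj_diff)

lemma C_QG_inverse: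
  assumes f: "f \<in> C_QG" and ge: "\<And>x. cmod (f x) \<ge> 1"
  shows "(\<lambda>x. inverse (f x)) \<in> C_QG"
proof (rule C_QG_dominated[OF f f, of _ 1])
  fix x y
  have nz: "f x \<noteq> 0" "f y \<noteq> 0" using ge[of x] ge[of y] by auto
  have "inverse (cmod (f z)) \<le> 1" for z using ge[of z] by (simp add: inverse_le_1_iff)
  then have le: "cmod (inverse (f x)) * cmod (f x - f y) * cmod (inverse (f y)) \<le> 1 * cmod (f x - f y) * 1"
    by (intro mult_mono) (auto simp: norm_inverse)
  have "cmod (inverse (f x) - inverse (f y)) =
      cmod (inverse (f x)) * cmod (f x - f y) * cmod (inverse (f y))"
    unfolding inverse_diff_inverse[OF nz] by (simp add: norm_mult)
  also note le
  also have "1 * cmod (f x - f y) * 1 \<le> 1 * (cmod (f x - f y) + cmod (f x - f y))"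
    by simp
  finally show "cmod (inverse (f x) - inverse (f y)) \<le> 1 * (cmod (f x - f y) + cmod (f x - f y))" .
qed

section \<open>Quasi-geodesics in hyperbolic spaces and a membership criterion\<close>

lemma integral_quasi_geodesic_bounds:
  assumes "integral_quasi_geodesic k k D h" "x \<in> D" "y \<in> D"
  shows "\<bar>real x - real y\<bar> / k - k \<le> dist (h x) (h y)"
    and "dist (h x) (h y) \<le> k * \<bar>real x - real y\<bar> + k"
  using assms unfolding integral_quasi_geodesic_def by blast+

lemma integral_quasi_geodesic_interval:
  assumes "integral_quasi_geodesic k k D h" "x \<in> D" "z \<in> D" "x \<le> y" "y \<le> z"
  shows "y \<in> D"
proof -
  obtain l r :: ereal where D: "D = {n. n \<ge> 1 \<and> l < ereal (real n) \<and> ereal (real n) < r}"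
    using assms(1) unfolding integral_quasi_geodesic_def by blast
  have le: "ereal (real x) \<le> ereal (real y)" "ereal (real y) \<le> ereal (real z)" using assms by auto
  have "1 \<le> y" "l < ereal (real y)" using assms(2,4) less_le_trans[OF _ le(1)] unfolding D by auto
  moreover have "ereal (real y) < r" using assms(3) le_less_trans[OF le(2)] unfolding D by blast
  ultimately show ?thesis unfolding D by blast
qed

context hyperbolic_space
begin

text \<open>
  A weak form of the stability of quasi-geodesics: beyond time \<open>m\<close> a
  quasi-geodesic stays in one shadow of depth comparable with \<open>m\<close>. The proof walks from \<open>m\<close> to
  \<open>i\<close> in strides of a fixed length \<open>L\<close>. Each application of hyperbolicity loses \<open>\<delta>\<close>, but the lower
  bound for the distance from the origin grows by \<open>L / k \<ge> \<delta>\<close> per stride, which compensates for it.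
\<close>

lemma quasi_geodesic_Gromov_product:
  assumes k: "k \<ge> 1"
  obtains C where "\<And>D h (b::'a) m i. integral_quasi_geodesic k k D h \<Longrightarrow> originates_at D h b \<Longrightarrow>
      m \<in> D \<Longrightarrow> i \<in> D \<Longrightarrow> m \<le> i \<Longrightarrow> real m / k - C \<le> Gromov_product b (h m) (h i)"
proof -
  \<comment> \<open>positive, so that the induction on \<open>i - m\<close> makes progress\<close>
  define L where "L = Suc (nat \<lceil>k * \<delta>\<rceil>)"
  have L: "L \<ge> 1" "k * \<delta> \<le> real L" unfolding L_def by linarith+
  define C where "C = 1 / k + 2 * k + k * L + \<delta>"
  have near: "real m / k - C + \<delta> \<le> Gromov_product b (h m) (h i)"
    if h: "integral_quasi_geodesic k k D h" "originates_at D h b" and m: "m \<in> D" and i: "i \<in> D"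
      and le: "m \<le> i" "i \<le> m + L" for D h m i and b :: 'a
  proof -
    have D1: "1 \<in> D" "h 1 = b" using h(2) unfolding originates_at_def by auto
    have "m \<ge> 1" using m h(1) unfolding integral_quasi_geodesic_def by blast
    then have "(real m - 1) / k - k \<le> dist (h m) b"
      using integral_quasi_geodesic_bounds(1)[OF h(1) m D1(1)] D1(2) by auto
    moreover have "dist (h m) (h i) \<le> k * L + k"
    proof -
      have "k * \<bar>real m - real i\<bar> \<le> k * L" using le k by (intro mult_left_mono) auto
      then show ?thesis using integral_quasi_geodesic_bounds(2)[OF h(1) m i] by linarith
    qed
    ultimately show ?thesis
      using Gromov_product_ge_dist[of "h m" b "h i"] unfolding C_def by (simp add: diff_divide_distrib)
  qed
  have "real m / k - C \<le> Gromov_product b (h m) (h i)"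
    if h: "integral_quasi_geodesic k k D h" "originates_at D h b" and "m \<in> D" "i \<in> D" "m \<le> i"
    for D h m i and b :: 'a
    using that(3-)
  proof (induction "i - m" arbitrary: m rule: less_induct)
    case less
    show ?case
    proof (cases "i \<le> m + L")
      case True
      then show ?thesis using near[OF h less.prems True] delta_pos by linarith
    next
      case False
      have mL: "m + L \<in> D"
        by (rule integral_quasi_geodesic_interval[OF h(1) less.prems(1,2)]) (use False in auto)
      have "real (m + L) / k - C \<le> Gromov_product b (h (m + L)) (h i)"
        by (rule less.hyps) (use False L(1) mL less.prems in auto)
      moreover have "\<delta> \<le> real L / k"
        using L(2) k by (simp add: field_simps)
      ultimately have "real m / k - C + \<delta> \<le> Gromov_product b (h (m + L)) (h i)"
        by (simp add: add_divide_distrib)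
      moreover have "real m / k - C + \<delta> \<le> Gromov_product b (h m) (h (m + L))"
        by (rule near[OF h less.prems(1) mL]) auto
      ultimately show ?thesis
        using hyperbolic_trans[of "real m / k - C + \<delta>" b "h m" "h (m + L)" "h i"] by simp
    qed
  qed
  then show ?thesis using that by blast
qed

text \<open>
  Continuity at infinity in terms of Gromov products suffices for membership. Two points at bounded
  distance which are far away, and any two points of a deep cone, have a large Gromov product; for
  cones this is the previous lemma, used twice at the common point \<open>g m\<close>.
\<close>

lemma C_QG_criterion:
  fixes f :: "'a \<Rightarrow> complex"
  assumes bd: "bounded (range f)" and cont: "continuous_on UNIV f"
    and osc: "\<And>e. e > 0 \<Longrightarrow> \<exists>R. \<forall>x y. R \<le> Gromov_product a x y \<longrightarrow> cmod (f x - f y) < e"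
  shows "f \<in> C_QG"
proof -
  have "slowly_oscillating f"
    unfolding slowly_oscillating_def
  proof (intro allI impI)
    fix x0 :: 'a and x y :: "nat \<Rightarrow> 'a" and M
    assume *: "M > 0 \<and> filterlim (\<lambda>n. dist x0 (x n)) at_top sequentially \<and> (\<forall>n. dist (x n) (y n) < M)"
    show "(\<lambda>n. cmod (f (x n) - f (y n))) \<longlonglongrightarrow> 0"
    proof (rule tendstoI)
      fix e :: real assume "e > 0"
      then obtain R where R: "\<forall>x y. R \<le> Gromov_product a x y \<longrightarrow> cmod (f x - f y) < e"
        using osc by blast
      have "\<forall>\<^sub>F n in sequentially. R + M + dist x0 a \<le> dist x0 (x n)"
        using * unfolding filterlim_at_top by blast
      then show "\<forall>\<^sub>F n in sequentially. dist (cmod (f (x n) - f (y n))) 0 < e"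
      proof eventually_elim
        case (elim n)
        have "R + M \<le> dist (x n) a"
          using elim dist_triangle[of x0 "x n" a] by (simp add: dist_commute)
        then have "R \<le> Gromov_product a (x n) (y n)"
          using Gromov_product_ge_dist[of "x n" a "y n"] * by (smt (verit))
        then show ?case using R by simp
      qed
    qed
  qed
  moreover have "\<exists>m\<ge>1. \<forall>x\<in>QG_cone x0 k k g m. \<forall>y\<in>QG_cone x0 k k g m. cmod (f x - f y) < e"
    if k: "k \<ge> 1" and g: "integral_quasi_geodesic_ray k k g" "originates_at {1..} g x0" and e: "e > 0"
    for k e and x0 :: 'a and g
  proof -
    obtain R where R: "\<forall>x y. R \<le> Gromov_product a x y \<longrightarrow> cmod (f x - f y) < e"
      using osc e by blast
    obtain C where C: "\<And>D h (b::'a) m i. integral_quasi_geodesic k k D h \<Longrightarrow> originates_at D h b \<Longrightarrow>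
        m \<in> D \<Longrightarrow> i \<in> D \<Longrightarrow> m \<le> i \<Longrightarrow> real m / k - C \<le> Gromov_product b (h m) (h i)"
      using quasi_geodesic_Gromov_product[OF k] by blast
    define T where "T = R + dist a x0 + \<delta>"
    obtain m :: nat where m: "m \<ge> 1" "real m \<ge> k * (T + C)"
      using real_arch_simple[of "max 1 (k * (T + C))"] by auto
    have T: "T \<le> real m / k - C" using m(2) k by (simp add: field_simps)
    have in_cone: "T \<le> Gromov_product x0 x (g m)" if "x \<in> QG_cone x0 k k g m" for x
    proof -
      obtain D h i where h: "integral_quasi_geodesic k k D h" "originates_at D h x0" "i \<in> D" "i \<ge> m"
        "x = h i" "\<forall>j\<in>{1..m}. h j = g j"
        using \<open>x \<in> QG_cone x0 k k g m\<close> unfolding QG_cone_def by blast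
      have "1 \<in> D" using h(2) unfolding originates_at_def by blast
      then have "m \<in> D" using integral_quasi_geodesic_interval[OF h(1) _ h(3)] m(1) h(4) by blast
      then have "T \<le> Gromov_product x0 (h m) (h i)"
        using C[OF h(1,2) _ h(3,4)] T by linarith
      then show ?thesis using h(5,6) m(1) by (simp add: Gromov_product_commute)
    qed
    have "cmod (f x - f y) < e" if x: "x \<in> QG_cone x0 k k g m" and y: "y \<in> QG_cone x0 k k g m" for x y
    proof -
      have "T - \<delta> \<le> Gromov_product x0 x y"
        using hyperbolic_trans[of T x0 x "g m" y] in_cone[OF x] in_cone[OF y] by (simp add: Gromov_product_commute)
      then have "R \<le> Gromov_product a x y"
        using Gromov_product_change_base[of x0 x y a] unfolding T_def by (simp add: dist_commute)
      then show ?thesis using R by blast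
    qed
    with m(1) show ?thesis by blast
  qed
  ultimately show ?thesis unfolding C_QG_iff using bd cont by blast
qed

end

section \<open>Extending functions to the Gromov boundary\<close>

text \<open>
  The two kinds of quasi-geodesics built below, rays (\<open>r = \<infinity>\<close>) and finite ones, come with an additive
  error only; then one constant \<open>k\<close> serves as multiplicative and as additive constant.
\<close>

lemma integral_quasi_geodesic_near_isometry:
  fixes r :: ereal
  assumes k: "k \<ge> 1" and D: "D = {n. n \<ge> 1 \<and> ereal (real n) < r}"
    and iso: "\<And>i j. i \<in> D \<Longrightarrow> j \<in> D \<Longrightarrow> \<bar>dist (h i) (h j) - \<bar>real i - real j\<bar>\<bar> \<le> k"
  shows "integral_quasi_geodesic k k D h"
  unfolding integral_quasi_geodesic_def
proof (intro conjI ballI)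
  show "1 \<le> k" "0 \<le> k" using k by auto
  have "D = {n. n \<ge> 1 \<and> 0 < ereal (real n) \<and> ereal (real n) < r}" unfolding D by auto
  then show "\<exists>l r. D = {n. 1 \<le> n \<and> l < ereal (real n) \<and> ereal (real n) < r}" by blast
next
  fix i j assume ij: "i \<in> D" "j \<in> D"
  have "\<bar>real i - real j\<bar> / k \<le> \<bar>real i - real j\<bar>"
    using k mult_left_mono[of 1 k "\<bar>real i - real j\<bar>"] by (simp add: divide_le_eq)
  moreover have "\<bar>real i - real j\<bar> \<le> k * \<bar>real i - real j\<bar>"
    using k mult_right_mono[of 1 k "\<bar>real i - real j\<bar>"] by simp
  ultimately show "\<bar>real i - real j\<bar> / k - k \<le> dist (h i) (h j)"
    "dist (h i) (h j) \<le> k * \<bar>real i - real j\<bar> + k"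
    using iso[OF ij] by linarith+
qed

locale geodesic_hyperbolic_space = hyperbolic_space a \<delta> for a :: "'a::metric_space" and \<delta> +
  assumes geodesic: "geodesic_space TYPE('a)"
begin

text \<open>
  A chosen unit speed geodesic from the base point to \<open>x\<close>, extended by staying at \<open>x\<close>, so that
  geodesics to different points can be compared at the same time.
\<close>

definition geodesic_to :: "'a \<Rightarrow> real \<Rightarrow> 'a" where
  "geodesic_to x = (SOME \<gamma>. (\<forall>t\<ge>dist x a. \<gamma> t = x) \<and> \<gamma> 0 = a \<and>
     (\<forall>s\<ge>0. \<forall>t\<ge>0. dist (\<gamma> s) (\<gamma> t) = \<bar>min s (dist x a) - min t (dist x a)\<bar>))"

lemma geodesic_to:
  "(\<forall>t\<ge>dist x a. geodesic_to x t = x) \<and> geodesic_to x 0 = a \<and>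
   (\<forall>s\<ge>0. \<forall>t\<ge>0. dist (geodesic_to x s) (geodesic_to x t) = \<bar>min s (dist x a) - min t (dist x a)\<bar>)"
proof -
  obtain \<gamma> where \<gamma>: "\<gamma> 0 = a" "\<gamma> (dist a x) = x"
    "\<forall>s\<in>{0..dist a x}. \<forall>t\<in>{0..dist a x}. dist (\<gamma> s) (\<gamma> t) = \<bar>s - t\<bar>"
    using geodesic unfolding geodesic_space_def by meson
  have "dist (\<gamma> (min s (dist x a))) (\<gamma> (min t (dist x a))) = \<bar>min s (dist x a) - min t (dist x a)\<bar>"
    if "0 \<le> s" "0 \<le> t" for s t
    by (rule \<gamma>(3)[rule_format]) (use that in \<open>auto simp: dist_commute\<close>)
  then have "\<exists>\<gamma>. (\<forall>t\<ge>dist x a. \<gamma> t = x) \<and> \<gamma> 0 = a \<and>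
     (\<forall>s\<ge>0. \<forall>t\<ge>0. dist (\<gamma> s) (\<gamma> t) = \<bar>min s (dist x a) - min t (dist x a)\<bar>)"
    using \<gamma>(1,2) by (intro exI[of _ "\<lambda>t. \<gamma> (min t (dist x a))"]) (auto simp: dist_commute min_def)
  from someI_ex[OF this] show ?thesis unfolding geodesic_to_def .
qed

lemma geodesic_to_end: "dist x a \<le> t \<Longrightarrow> geodesic_to x t = x"
  using geodesic_to by blast

lemma dist_geodesic_to:
  "0 \<le> s \<Longrightarrow> 0 \<le> t \<Longrightarrow>
    dist (geodesic_to x s) (geodesic_to x t) = \<bar>min s (dist x a) - min t (dist x a)\<bar>"
  using geodesic_to by blast

lemma dist_geodesic_to_base: "0 \<le> t \<Longrightarrow> t \<le> dist x a \<Longrightarrow> dist (geodesic_to x t) a = t"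
  using dist_geodesic_to[of t 0 x] geodesic_to[of x] by simp

lemma Gromov_product_geodesic_to: "0 \<le> t \<Longrightarrow> t \<le> dist x a \<Longrightarrow> Gromov_product a (geodesic_to x t) x = t"
  using dist_geodesic_to[of t "dist x a" x] geodesic_to_end[of x "dist x a"]
  by (simp add: Gromov_product_def dist_geodesic_to_base)

lemma geodesic_to_fellow_travel:
  assumes "0 \<le> t" "t \<le> Gromov_product a x y"
  shows "dist (geodesic_to x t) (geodesic_to y t) \<le> 4 * \<delta>"
proof -
  have t: "t \<le> dist x a" "t \<le> dist y a"
    using assms Gromov_product_le_dist_left[of a x y] Gromov_product_le_dist_right[of a x y] by auto
  have "t - 2 * \<delta> \<le> Gromov_product a (geodesic_to x t) (geodesic_to y t)"
    by (rule hyperbolic_trans2[of _ _ _ x y])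
      (use assms t Gromov_product_geodesic_to in \<open>simp_all add: Gromov_product_commute[of _ y]\<close>)
  then show ?thesis
    using dist_geodesic_to_base assms t by (simp add: Gromov_product_def field_simps)
qed

text \<open>
  The cone condition controls a function near a boundary point as follows. Geodesics to the points
  \<open>u n\<close> fellow travel longer and longer, so they splice into one quasi-geodesic ray \<open>g\<close>: take
  \<open>g i\<close> at distance \<open>i - 1\<close> on the geodesic to a far member of the sequence. If \<open>x\<close> has a large
  Gromov product with the tail of \<open>u\<close>, then the geodesic to \<open>x\<close> follows \<open>g\<close> for a long time \<open>m\<close>.
  Switching from \<open>g\<close> to this geodesic at time \<open>m\<close> gives a quasi-geodesic, with constants not
  depending on \<open>m\<close>, so \<open>x\<close> lies in the \<open>m\<close>-cone of \<open>g\<close>.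
\<close>

lemma Gromov_sequence_cones:
  assumes u: "u \<in> Gromov_sequences a"
  obtains k g where "k \<ge> 1" "integral_quasi_geodesic_ray k k g" "originates_at {1..} g a"
    "\<And>m N x. m \<ge> 1 \<Longrightarrow> (\<And>n. N \<le> n \<Longrightarrow> real m \<le> Gromov_product a (u n) x) \<Longrightarrow>
       x \<in> QG_cone a k k g m"
proof -
  have "\<exists>N. \<forall>m\<ge>N. \<forall>n\<ge>N. real i \<le> Gromov_product a (u m) (u n)" for i
    using Gromov_sequenceD[OF u, of "real i"] by metis
  then obtain N where N: "\<And>i m n. N i \<le> m \<Longrightarrow> N i \<le> n \<Longrightarrow> real i \<le> Gromov_product a (u m) (u n)"
    by metis
  define g where "g i = geodesic_to (u (N i)) (real i - 1)" for i
  \<comment> \<open>an error of \<open>8 * \<delta>\<close> at either end point, and \<open>1\<close> for rounding the time of arrival at \<open>x\<close>\<close>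
  define k where "k = 16 * \<delta> + 1"
  have k: "k \<ge> 1" using delta_pos by (simp add: k_def)
  have g_near: "dist (g i) (geodesic_to (u n) (real i - 1)) \<le> 4 * \<delta>" if "i \<ge> 1" "n \<ge> N i" for i n
    unfolding g_def
    by (rule geodesic_to_fellow_travel) (use N[of i "N i" n] that in auto)
  have g1: "g 1 = a" unfolding g_def using geodesic_to by simp
  have ray: "integral_quasi_geodesic_ray k k g"
    unfolding integral_quasi_geodesic_ray_def
  proof (rule integral_quasi_geodesic_near_isometry[where r = \<infinity>, OF k])
    fix i j :: nat assume "i \<in> {1..}" "j \<in> {1..}"
    then have ij: "i \<ge> 1" "j \<ge> 1" by auto
    define n where "n = max (N i) (N j)"
    have "real i \<le> dist (u n) a" "real j \<le> dist (u n) a"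
      using N[of i n n] N[of j n n] Gromov_product_le_dist_left[of a "u n" "u n"]
      unfolding n_def by auto
    then have "dist (geodesic_to (u n) (real i - 1)) (geodesic_to (u n) (real j - 1)) = \<bar>real i - real j\<bar>"
      using ij dist_geodesic_to[of "real i - 1" "real j - 1" "u n"] by simp
    moreover have "dist (g i) (geodesic_to (u n) (real i - 1)) \<le> 4 * \<delta>"
      "dist (g j) (geodesic_to (u n) (real j - 1)) \<le> 4 * \<delta>"
      using g_near ij unfolding n_def by auto
    ultimately show "\<bar>dist (g i) (g j) - \<bar>real i - real j\<bar>\<bar> \<le> k"
      using delta_pos unfolding k_def
      by (smt (verit) dist_commute dist_triangle)
  qed auto
  have "x \<in> QG_cone a k k g m"
    if m: "m \<ge> 1" and x: "\<And>n. M \<le> n \<Longrightarrow> real m \<le> Gromov_product a (u n) x" for m M x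
  proof -
    define c where "c j = geodesic_to x (real j - 1)" for j :: nat
    define h where "h j = (if j \<le> m then g j else c j)" for j
    \<comment> \<open>the first integral time at which the geodesic has reached \<open>x\<close>, shifted by one because
      the domain starts at \<open>1\<close>\<close>
    define I where "I = nat \<lceil>dist x a\<rceil> + 1"
    have "m \<le> dist x a" using x[of M] Gromov_product_le_dist_right[of a "u M" x] by simp
    then have mI: "m \<le> I" "m < I" unfolding I_def by linarith+
    have I: "dist x a \<le> real I - 1" "real I - 1 < dist x a + 1"
      unfolding I_def using zero_le_dist[of x a] by linarith+
    have h_near: "dist (h j) (c j) \<le> 8 * \<delta>" if "j \<ge> 1" for j
    proof (cases "j \<le> m")
      case True
      define n where "n = max M (N j)"
      have "dist (g j) (geodesic_to (u n) (real j - 1)) \<le> 4 * \<delta>"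
        using g_near[OF that] unfolding n_def by simp
      moreover have "dist (geodesic_to (u n) (real j - 1)) (c j) \<le> 4 * \<delta>"
        unfolding c_def
        by (rule geodesic_to_fellow_travel) (use x[of n] True that in \<open>auto simp: n_def\<close>)
      ultimately show ?thesis
        using True dist_triangle[of "g j" "c j" "geodesic_to (u n) (real j - 1)"] by (simp add: h_def)
    qed (use delta_pos in \<open>simp add: h_def\<close>)
    have qg: "integral_quasi_geodesic k k {1..I} h"
    proof (rule integral_quasi_geodesic_near_isometry[where r = "ereal (real I + 1)", OF k])
      show "{1..I} = {n. 1 \<le> n \<and> ereal (real n) < ereal (real I + 1)}" by auto
      fix i j assume "i \<in> {1..I}" "j \<in> {1..I}"
      then have ij: "1 \<le> i" "1 \<le> j" "i \<le> I" "j \<le> I" by auto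
      have "dist (c i) (c j) = \<bar>min (real i - 1) (dist x a) - min (real j - 1) (dist x a)\<bar>"
        unfolding c_def by (rule dist_geodesic_to) (use ij in auto)
      moreover have "real i \<le> real I" "real j \<le> real I" using ij by auto
      ultimately have "\<bar>dist (c i) (c j) - \<bar>real i - real j\<bar>\<bar> \<le> 1"
        using I by (simp add: min_def abs_if split: if_splits)
      then show "\<bar>dist (h i) (h j) - \<bar>real i - real j\<bar>\<bar> \<le> k"
        using h_near[OF ij(1)] h_near[OF ij(2)] unfolding k_def
        by (smt (verit) dist_commute dist_triangle)
    qed
    have "h I = x"
      using mI I geodesic_to_end unfolding h_def c_def by simp
    moreover have "originates_at {1..I} h a"
      using m mI g1 unfolding originates_at_def h_def by simp
    ultimately show ?thesis
      unfolding QG_cone_def mem_Collect_eq using qg mI(1) m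
      by (intro exI[of _ "{1..I}"] exI[of _ h] exI[of _ I]) (auto simp: h_def)
  qed
  moreover have "originates_at {1..} g a" using g1 by (simp add: originates_at_def)
  ultimately show ?thesis using that k ray by blast
qed

lemma C_QG_small_near_boundary:
  assumes f: "f \<in> C_QG" and u: "u \<in> Gromov_sequences a" and e: "e > 0"
  obtains R where "\<And>x y N. (\<And>n. N \<le> n \<Longrightarrow> R \<le> Gromov_product a (u n) x) \<Longrightarrow>
      (\<And>n. N \<le> n \<Longrightarrow> R \<le> Gromov_product a (u n) y) \<Longrightarrow> cmod (f x - f y) < e"
proof -
  obtain k g where g: "k \<ge> 1" "integral_quasi_geodesic_ray k k g" "originates_at {1..} g a"
    and cone: "\<And>m N x. m \<ge> 1 \<Longrightarrow> (\<And>n. N \<le> n \<Longrightarrow> real m \<le> Gromov_product a (u n) x) \<Longrightarrow>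
       x \<in> QG_cone a k k g m"
    using Gromov_sequence_cones[OF u] by blast
  obtain m where m: "m \<ge> 1"
    "\<And>x y. x \<in> QG_cone a k k g m \<Longrightarrow> y \<in> QG_cone a k k g m \<Longrightarrow> cmod (f x - f y) < e"
    using C_QG_cone[OF f g e] by blast
  show ?thesis
    by (rule that[of "real m"]) (blast intro: m cone)
qed

lemma C_QG_boundary_limit:
  assumes f: "f \<in> C_QG" and \<xi>: "\<xi> \<in> Gromov_boundary a"
  obtains l where "\<And>u. u \<in> \<xi> \<Longrightarrow> (\<lambda>n. f (u n)) \<longlonglongrightarrow> l"
proof -
  have cauchy: "\<exists>N. \<forall>m\<ge>N. \<forall>n\<ge>N. cmod (f (u m) - f (v n)) < e"
    if u: "u \<in> \<xi>" and v: "v \<in> \<xi>" and e: "e > 0" for u v e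
  proof -
    obtain R where R: "\<And>x y N. (\<And>n. N \<le> n \<Longrightarrow> R \<le> Gromov_product a (u n) x) \<Longrightarrow>
      (\<And>n. N \<le> n \<Longrightarrow> R \<le> Gromov_product a (u n) y) \<Longrightarrow> cmod (f x - f y) < e"
      using C_QG_small_near_boundary[OF f boundary_sequence[OF \<xi> u] e] by blast
    obtain N where N: "\<And>m n. N \<le> m \<Longrightarrow> N \<le> n \<Longrightarrow> R \<le> Gromov_product a (u m) (u n)"
      using Gromov_relD[OF boundary_rel[OF \<xi> u u]] by blast
    obtain M where M: "\<And>m n. M \<le> m \<Longrightarrow> M \<le> n \<Longrightarrow> R \<le> Gromov_product a (u m) (v n)"
      using Gromov_relD[OF boundary_rel[OF \<xi> u v]] by blast
    have "cmod (f (u m) - f (v n)) < e" if "max M N \<le> m" "max M N \<le> n" for m n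
      by (rule R[of "max M N"]) (use N M that in auto)
    then show ?thesis by blast
  qed
  obtain w where w: "w \<in> \<xi>" using boundary_nonempty[OF \<xi>] .
  have "Cauchy (\<lambda>n. f (w n))"
    unfolding Cauchy_def dist_norm using cauchy[OF w w] by blast
  then obtain l where l: "(\<lambda>n. f (w n)) \<longlonglongrightarrow> l" using Cauchy_convergent convergent_def by blast
  have "(\<lambda>n. f (u n)) \<longlonglongrightarrow> l" if u: "u \<in> \<xi>" for u
  proof -
    have "(\<lambda>n. f (u n) - f (w n)) \<longlonglongrightarrow> 0"
    proof (rule LIMSEQ_I)
      fix e :: real assume "e > 0"
      then show "\<exists>N. \<forall>n\<ge>N. norm (f (u n) - f (w n) - 0) < e"
        using cauchy[OF u w] by (metis diff_zero)
    qed
    from tendsto_add[OF this l] show ?thesis by simp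
  qed
  then show ?thesis using that by blast
qed

text \<open>
  On the boundary, the common limit along the representing sequences. The description is proper only
  for functions of the algebra, by the previous lemma.
\<close>

definition extension :: "('a \<Rightarrow> complex) \<Rightarrow> 'a Gromov_point \<Rightarrow> complex" where
  "extension f z = (case z of Inl x \<Rightarrow> f x | Inr \<xi> \<Rightarrow> (THE l. \<forall>u\<in>\<xi>. (\<lambda>n. f (u n)) \<longlonglongrightarrow> l))"

lemma extension_Inl [simp]: "extension f (Inl x) = f x"
  by (simp add: extension_def)

lemma extension_tendsto:
  assumes f: "f \<in> C_QG" and \<xi>: "\<xi> \<in> Gromov_boundary a" and u: "u \<in> \<xi>"
  shows "(\<lambda>n. f (u n)) \<longlonglongrightarrow> extension f (Inr \<xi>)"
proof -
  obtain l where l: "\<And>u. u \<in> \<xi> \<Longrightarrow> (\<lambda>n. f (u n)) \<longlonglongrightarrow> l" using C_QG_boundary_limit[OF f \<xi>] by blast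
  have "extension f (Inr \<xi>) = l"
    unfolding extension_def sum.case
    by (rule the_equality) (use l u LIMSEQ_unique in blast)+
  then show ?thesis using l u by simp
qed

lemma extension_eqI:
  "f \<in> C_QG \<Longrightarrow> \<xi> \<in> Gromov_boundary a \<Longrightarrow> u \<in> \<xi> \<Longrightarrow> (\<lambda>n. f (u n)) \<longlonglongrightarrow> l \<Longrightarrow>
    extension f (Inr \<xi>) = l"
  using extension_tendsto LIMSEQ_unique by blast

lemma extension_tendsto_representing:
  assumes f: "f \<in> C_QG" and z: "z \<in> Gromov_points a" and u: "u \<in> representing_sequences z"
  shows "(\<lambda>n. f (u n)) \<longlonglongrightarrow> extension f z"
proof (cases z)
  case (Inl x)
  then show ?thesis
    using isCont_tendsto_compose[OF C_QG_isCont[OF f], of u x sequentially] u by simp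
next
  case (Inr \<xi>)
  then show ?thesis using extension_tendsto[OF f, of \<xi> u] z u by (auto simp: Gromov_points_def)
qed

lemma continuous_map_extension:
  assumes f: "f \<in> C_QG"
  shows "continuous_map (Gromov_compactification a) euclidean (extension f)"
  unfolding continuous_map_def
proof (intro conjI allI impI)
  fix U :: "complex set" assume "openin euclidean U"
  then have U: "open U" by simp
  let ?P = "{z \<in> topspace (Gromov_compactification a). extension f z \<in> U}"
  show "openin (Gromov_compactification a) ?P"
    unfolding openin_Gromov_compactification Gromov_open_def topspace_Gromov_compactification
  proof (intro conjI allI impI)
    have "{x. Inl x \<in> {z \<in> Gromov_points a. extension f z \<in> U}} = f -` U"
      by (auto simp: Gromov_points_def)
    moreover have "open (f -` U)"
      using continuous_open_vimage[OF U, of f] C_QG_isCont[OF f] by blast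
    ultimately show "open {x. Inl x \<in> {z \<in> Gromov_points a. extension f z \<in> U}}" by simp
  next
    fix \<xi> assume "Inr \<xi> \<in> {z \<in> Gromov_points a. extension f z \<in> U}"
    then have \<xi>: "\<xi> \<in> Gromov_boundary a" "extension f (Inr \<xi>) \<in> U" by (auto simp: Gromov_points_def)
    obtain e where e: "e > 0" "\<And>w. cmod (w - extension f (Inr \<xi>)) < e \<Longrightarrow> w \<in> U"
      using U \<xi>(2) unfolding open_dist dist_norm by metis
    obtain u where u: "u \<in> \<xi>" using boundary_nonempty[OF \<xi>(1)] .
    obtain R where R: "\<And>x y N. (\<And>n. N \<le> n \<Longrightarrow> R \<le> Gromov_product a (u n) x) \<Longrightarrow>
      (\<And>n. N \<le> n \<Longrightarrow> R \<le> Gromov_product a (u n) y) \<Longrightarrow> cmod (f x - f y) < e / 2"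
      using C_QG_small_near_boundary[OF f boundary_sequence[OF \<xi>(1) u], of "e / 2"] e(1) by auto
    obtain M where M: "\<And>m n. M \<le> m \<Longrightarrow> M \<le> n \<Longrightarrow> R \<le> Gromov_product a (u m) (u n)"
      using Gromov_relD[OF boundary_rel[OF \<xi>(1) u u]] by blast
    have "extension f z \<in> U"
      if z: "z \<in> Gromov_points a" and gt: "ereal (R + \<delta>) < extended_Gromov_product a (Inr \<xi>) z" for z
    proof -
      obtain v N where v: "v \<in> representing_sequences z"
        and N: "\<And>m n. N \<le> m \<Longrightarrow> N \<le> n \<Longrightarrow> R \<le> Gromov_product a (u m) (v n)"
        using extended_product_gtD[OF \<xi>(1) u gt] by blast
      have "cmod (f (v n) - f (u n)) < e / 2" if "max M N \<le> n" for n
        by (rule R[of "max M N"]) (use N M that in auto)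
      then have "\<forall>\<^sub>F n in sequentially. cmod (f (v n) - f (u n)) \<le> e / 2"
        unfolding eventually_sequentially by (meson less_imp_le)
      moreover have "(\<lambda>n. cmod (f (v n) - f (u n))) \<longlonglongrightarrow> cmod (extension f z - extension f (Inr \<xi>))"
        by (intro tendsto_intros extension_tendsto_representing[OF f z v] extension_tendsto[OF f \<xi>(1) u])
      ultimately have "cmod (extension f z - extension f (Inr \<xi>)) \<le> e / 2"
        using tendsto_upperbound[OF _ _ sequentially_bot] by blast
      then show ?thesis using e by simp
    qed
    then show "\<exists>r. {z \<in> Gromov_points a. ereal r < extended_Gromov_product a (Inr \<xi>) z}
        \<subseteq> {z \<in> Gromov_points a. extension f z \<in> U}" by blast
  qed auto
qed auto

end

section \<open>Compactness of the Gromov compactification\<close>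

locale proper_hyperbolic_space = geodesic_hyperbolic_space a \<delta> for a :: "'a::metric_space" and \<delta> +
  assumes proper: "proper_space TYPE('a)"
begin

definition shadow :: "'a \<Rightarrow> real \<Rightarrow> 'a Gromov_point set" where
  "shadow p R = Inl ` {x. R \<le> Gromov_product a p x} \<union>
     Inr ` {\<xi> \<in> Gromov_boundary a. \<exists>v\<in>\<xi>. \<exists>N. \<forall>n\<ge>N. R \<le> Gromov_product a p (v n)}"

lemma shadow_antimono: "R \<le> S \<Longrightarrow> shadow p S \<subseteq> shadow p R"
  unfolding shadow_def by (intro Un_mono image_mono Collect_mono; meson order_trans)

lemma shadow_common_point:
  assumes p: "z \<in> shadow p R" and q: "z \<in> shadow q R"
  shows "R - 2 * \<delta> \<le> Gromov_product a p q"
proof (cases z)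
  case (Inl x)
  then have "R \<le> Gromov_product a p x" "R \<le> Gromov_product a x q"
    using p q by (auto simp: shadow_def Gromov_product_commute)
  then show ?thesis using hyperbolic_trans[of R a p x q] delta_pos by linarith
next
  case (Inr \<xi>)
  then obtain u v N M where \<xi>: "\<xi> \<in> Gromov_boundary a" "u \<in> \<xi>" "v \<in> \<xi>"
    and u: "\<And>n. N \<le> n \<Longrightarrow> R \<le> Gromov_product a p (u n)"
    and v: "\<And>n. M \<le> n \<Longrightarrow> R \<le> Gromov_product a q (v n)"
    using p q unfolding shadow_def by auto
  obtain K where K: "\<And>m n. K \<le> m \<Longrightarrow> K \<le> n \<Longrightarrow> R \<le> Gromov_product a (u m) (v n)"
    using Gromov_relD[OF boundary_rel[OF \<xi>]] by blast
  define n where "n = max K (max M N)"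
  show ?thesis
    by (rule hyperbolic_trans2[of R a p "u n" "v n" q])
      (use u v K in \<open>auto simp: n_def Gromov_product_commute\<close>)
qed

text \<open>
  A geodesic from the base point to a point outside the ball of radius \<open>r\<close> crosses the sphere of
  radius \<open>r\<close>. As the ball is compact, it has a finite \<open>1\<close>-net, and the net point next to the crossing
  casts a shadow on the given point.
\<close>

lemma finite_shadow_cover:
  assumes r: "0 \<le> r"
  obtains P where "finite P" "Gromov_points a \<subseteq> Inl ` cball a r \<union> (\<Union>p\<in>P. shadow p (r - 1 - \<delta>))"
proof -
  have "compact (cball a r)" using proper unfolding proper_space_def by blast
  then obtain P where P: "finite P" "cball a r \<subseteq> (\<Union>p\<in>P. ball p 1)"
    by (rule compactE_image[where C = "cball a r" and f = "\<lambda>p. ball p 1"]) auto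
  have net: "\<exists>p\<in>P. \<forall>y. R \<le> Gromov_product a (geodesic_to x r) y \<longrightarrow> R - 1 \<le> Gromov_product a p y"
    if "r \<le> dist x a" for x R
  proof -
    have "geodesic_to x r \<in> cball a r"
      using dist_geodesic_to_base[OF r that] by (simp add: dist_commute)
    then obtain p where p: "p \<in> P" "dist (geodesic_to x r) p < 1"
      using P(2) by (force simp: dist_commute)
    have "R - 1 \<le> Gromov_product a p y" if "R \<le> Gromov_product a (geodesic_to x r) y" for y
      using Gromov_product_lipschitz_left[of a "geodesic_to x r" y p] that p(2) by linarith
    with p(1) show ?thesis by blast
  qed
  have "z \<in> Inl ` cball a r \<union> (\<Union>p\<in>P. shadow p (r - 1 - \<delta>))" if z: "z \<in> Gromov_points a" for z
  proof (cases z)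
    case (Inl x)
    show ?thesis
    proof (cases "dist x a \<le> r")
      case True
      then show ?thesis using Inl by (simp add: dist_commute)
    next
      case False
      then have le: "r \<le> dist x a" by simp
      obtain p where "p \<in> P" "r - 1 \<le> Gromov_product a p x"
        using net[OF le, of r] Gromov_product_geodesic_to[OF r le] by auto
      then show ?thesis using Inl delta_pos by (force simp: shadow_def)
    qed
  next
    case (Inr \<xi>)
    then have \<xi>: "\<xi> \<in> Gromov_boundary a" using z by (auto simp: Gromov_points_def)
    obtain v where v: "v \<in> \<xi>" using boundary_nonempty[OF \<xi>] .
    obtain N where N: "\<And>m n. N \<le> m \<Longrightarrow> N \<le> n \<Longrightarrow> r \<le> Gromov_product a (v m) (v n)"
      using Gromov_relD[OF boundary_rel[OF \<xi> v v]] by blast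
    have le: "r \<le> dist (v N) a"
      using N[of N N] Gromov_product_le_dist_left[of a "v N" "v N"] by simp
    obtain p where p: "p \<in> P"
      "\<And>y. r - \<delta> \<le> Gromov_product a (geodesic_to (v N) r) y \<Longrightarrow> r - \<delta> - 1 \<le> Gromov_product a p y"
      using net[OF le, of "r - \<delta>"] by blast
    have "r - 1 - \<delta> \<le> Gromov_product a p (v n)" if "N \<le> n" for n
    proof -
      have "r - \<delta> \<le> Gromov_product a (geodesic_to (v N) r) (v n)"
        by (rule hyperbolic_trans[of r a _ "v N"])
          (use N[of N n] that Gromov_product_geodesic_to[OF r le] in auto)
      from p(2)[OF this] show ?thesis by simp
    qed
    then have "Inr \<xi> \<in> shadow p (r - 1 - \<delta>)"
      unfolding shadow_def using \<xi> v by blast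
    then show ?thesis using p(1) Inr by blast
  qed
  then show ?thesis using that P(1) by blast
qed

lemma compactin_Inl_cball: "compactin (Gromov_compactification a) (Inl ` cball a r)"
proof -
  have "continuous_map euclidean (Gromov_compactification a) Inl"
    unfolding continuous_map_def topspace_Gromov_compactification openin_Gromov_compactification
      Gromov_open_def by (auto simp: Gromov_points_def)
  moreover have "compactin euclidean (cball a r)"
    using proper unfolding proper_space_def by (auto simp: compactin_euclidean_iff)
  ultimately show ?thesis by (rule image_compactin[rotated])
qed

text \<open>
  Koenig's argument: if a cover had no finite subcover, then, by the previous lemma, one could choose
  points \<open>p n\<close> such that no finite intersection of their shadows, of depths tending to infinity, is
  finitely covered. In particular these intersections are nonempty, so the \<open>p n\<close> converge to a
  boundary point. But a member of the cover around this boundary point contains a whole shadow.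
\<close>

lemma compact_space_Gromov_compactification: "compact_space (Gromov_compactification a)"
  unfolding compact_space_alt topspace_Gromov_compactification
proof (intro allI impI, elim conjE)
  fix \<U> assume op: "\<forall>U\<in>\<U>. openin (Gromov_compactification a) U" and cover: "Gromov_points a \<subseteq> \<Union>\<U>"
  define bad where "bad A \<longleftrightarrow> A \<subseteq> Gromov_points a \<and> \<not> (\<exists>\<F>. finite \<F> \<and> \<F> \<subseteq> \<U> \<and> A \<subseteq> \<Union>\<F>)" for A
  have bad_step: "\<exists>p. bad (A \<inter> shadow p (real n - 1 - \<delta>))" if A: "bad A" for A n
  proof (rule ccontr)
    assume not_bad: "\<not> (\<exists>p. bad (A \<inter> shadow p (real n - 1 - \<delta>)))"
    have sub: "A \<subseteq> Gromov_points a" using A unfolding bad_def by blast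
    obtain P where P: "finite P"
      "Gromov_points a \<subseteq> Inl ` cball a (real n) \<union> (\<Union>p\<in>P. shadow p (real n - 1 - \<delta>))"
      using finite_shadow_cover[of "real n"] by auto
    have "\<exists>\<F>. finite \<F> \<and> \<F> \<subseteq> \<U> \<and> A \<inter> shadow p (real n - 1 - \<delta>) \<subseteq> \<Union>\<F>" for p
      using not_bad sub unfolding bad_def by blast
    then obtain F where F: "\<And>p. finite (F p)" "\<And>p. F p \<subseteq> \<U>"
      "\<And>p. A \<inter> shadow p (real n - 1 - \<delta>) \<subseteq> \<Union>(F p)" by metis
    have "Inl ` cball a (real n) \<subseteq> \<Union>\<U>" using cover by (auto simp: Gromov_points_def)
    then obtain \<F>0 where \<F>0: "finite \<F>0" "\<F>0 \<subseteq> \<U>" "Inl ` cball a (real n) \<subseteq> \<Union>\<F>0"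
      using compactin_Inl_cball[of "real n"] op unfolding compactin_def by meson
    have "A \<subseteq> \<Union>(\<F>0 \<union> (\<Union>p\<in>P. F p))"
    proof
      fix z assume z: "z \<in> A"
      then consider "z \<in> Inl ` cball a (real n)" | p where "p \<in> P" "z \<in> shadow p (real n - 1 - \<delta>)"
        using sub P(2) by blast
      then show "z \<in> \<Union>(\<F>0 \<union> (\<Union>p\<in>P. F p))"
      proof cases
        case 1
        then show ?thesis using \<F>0(3) by blast
      next
        case 2
        then show ?thesis using F(3)[of p] z by blast
      qed
    qed
    moreover have "finite (\<F>0 \<union> (\<Union>p\<in>P. F p))" "\<F>0 \<union> (\<Union>p\<in>P. F p) \<subseteq> \<U>"
      using \<F>0(1,2) P(1) F(1,2) by (simp, blast)
    ultimately show False using A unfolding bad_def by blast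
  qed
  show "\<exists>\<F>. finite \<F> \<and> \<F> \<subseteq> \<U> \<and> Gromov_points a \<subseteq> \<Union>\<F>"
  proof (rule ccontr)
    assume "\<not> ?thesis"
    then have "bad (Gromov_points a)" unfolding bad_def by blast
    then have "\<exists>A. \<forall>n. bad (A n) \<and> (\<exists>p. A (Suc n) = A n \<inter> shadow p (real n - 1 - \<delta>))"
      using dependent_nat_choice[of "\<lambda>_. bad" "\<lambda>n A B. \<exists>p. B = A \<inter> shadow p (real n - 1 - \<delta>)"] bad_step
      by metis
    then obtain A p where A: "\<And>n. bad (A n)" "\<And>n. A (Suc n) = A n \<inter> shadow (p n) (real n - 1 - \<delta>)"
      by metis
    have decr: "A n \<subseteq> A m" if "m \<le> n" for m n
      using that by (rule lift_Suc_antimono_le[rotated]) (use A(2) in blast)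
    have p: "real n - 1 - 3 * \<delta> \<le> Gromov_product a (p n) (p m)" if "n \<le> m" for m n
    proof -
      have "A (Suc m) \<noteq> {}" using A(1)[of "Suc m"] unfolding bad_def by auto
      then obtain z where z: "z \<in> A (Suc m)" by blast
      then have "z \<in> shadow (p m) (real m - 1 - \<delta>)" "z \<in> shadow (p n) (real n - 1 - \<delta>)"
        using A(2) decr[of "Suc n" "Suc m"] that by auto
      then have "real n - 1 - \<delta> - 2 * \<delta> \<le> Gromov_product a (p n) (p m)"
        using shadow_antimono[of "real n - 1 - \<delta>" "real m - 1 - \<delta>" "p m"] that
        by (intro shadow_common_point[of z]) auto
      then show ?thesis by simp
    qed
    have "p \<in> Gromov_sequences a"
    proof (rule Gromov_sequenceI)
      fix R
      have "R \<le> Gromov_product a (p m) (p n)"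
        if "nat \<lceil>R + 1 + 3 * \<delta>\<rceil> \<le> m" "nat \<lceil>R + 1 + 3 * \<delta>\<rceil> \<le> n" for m n
      proof -
        have "R + 1 + 3 * \<delta> \<le> real m" "R + 1 + 3 * \<delta> \<le> real n" using that by linarith+
        then show ?thesis
          using p[of m n] p[of n m] Gromov_product_commute[of a "p m" "p n"] by linarith
      qed
      then show "\<exists>N. \<forall>m\<ge>N. \<forall>n\<ge>N. R \<le> Gromov_product a (p m) (p n)" by blast
    qed
    then obtain \<xi> where \<xi>: "\<xi> \<in> Gromov_boundary a" "p \<in> \<xi>" using boundary_class by blast
    then obtain U where U: "U \<in> \<U>" "Inr \<xi> \<in> U" using cover by (force simp: Gromov_points_def)
    then obtain r where r: "{z \<in> Gromov_points a. ereal r < extended_Gromov_product a (Inr \<xi>) z} \<subseteq> U"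
      using op unfolding openin_Gromov_compactification Gromov_open_def by blast
    define n where "n = nat \<lceil>r + 2 + 4 * \<delta>\<rceil>"
    have n: "r + 1 \<le> real n - 1 - 4 * \<delta>" unfolding n_def by linarith
    have "A (Suc n) \<subseteq> U"
    proof
      fix z assume z: "z \<in> A (Suc n)"
      then have zp: "z \<in> Gromov_points a" using A(1)[of "Suc n"] unfolding bad_def by blast
      have "z \<in> shadow (p n) (real n - 1 - \<delta>)" using z A(2) by blast
      then obtain v N where v: "v \<in> representing_sequences z"
        "\<And>j. N \<le> j \<Longrightarrow> real n - 1 - \<delta> \<le> Gromov_product a (p n) (v j)"
      proof (cases z)
        case (Inl x)
        with \<open>z \<in> shadow _ _\<close> show thesis by (intro that[of "\<lambda>_. x"]) (auto simp: shadow_def)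
      next
        case (Inr \<eta>)
        with \<open>z \<in> shadow _ _\<close> that show thesis by (auto simp: shadow_def)
      qed
      have "ereal (r + 1) \<le> extended_Gromov_product a (Inr \<xi>) z"
      proof (rule extended_product_ge[of p _ v _ "max n N"])
        fix m j assume mj: "max n N \<le> m" "max n N \<le> j"
        have "real n - 1 - 3 * \<delta> - \<delta> \<le> Gromov_product a (p m) (v j)"
          by (rule hyperbolic_trans[of _ _ _ "p n"])
            (use mj p[of n m] v(2)[of j] delta_pos Gromov_product_commute[of a "p m" "p n"] in auto)
        then show "r + 1 \<le> Gromov_product a (p m) (v j)" using n by simp
      qed (use \<xi> v in auto)
      moreover have "ereal r < ereal (r + 1)" by simp
      ultimately have "ereal r < extended_Gromov_product a (Inr \<xi>) z" using less_le_trans by blast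
      then show "z \<in> U" using r zp by blast
    qed
    then have "finite {U} \<and> {U} \<subseteq> \<U> \<and> A (Suc n) \<subseteq> \<Union>{U}" using U(1) by simp
    then show False using A(1)[of "Suc n"] unfolding bad_def by blast
  qed
qed

end

section \<open>Functions separating the points of the Gromov compactification\<close>

lemma sum_lessThan_add:
  fixes f :: "nat \<Rightarrow> 'b::comm_monoid_add"
  shows "(\<Sum>i<m + k. f i) = (\<Sum>i<m. f i) + (\<Sum>i<k. f (m + i))"
  by (induction k) (simp_all add: add.assoc)

text \<open>
  Frink's metrization lemma: a quasi-metric with these weak triangle inequalities is, up to the
  factor \<open>2\<close>, a lower bound for the lengths of chains. One cuts a chain of length \<open>S\<close> at the step
  which crosses \<open>S / 2\<close>. By induction the two remaining chains have end points at quasi-distance at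
  most \<open>S\<close>, and so has the step itself. If the crossing step is the first or the last one, then a
  remaining chain is empty and the inequality for three points takes over.
\<close>

lemma Frink_chain_inequality:
  fixes \<rho> :: "'b \<Rightarrow> 'b \<Rightarrow> real"
  assumes pos: "\<And>x y. 0 < \<rho> x y"
    and two: "\<And>x y z. \<rho> x z \<le> 2 * max (\<rho> x y) (\<rho> y z)"
    and three: "\<And>x y z w. \<rho> x w \<le> 2 * max (\<rho> x y) (max (\<rho> y z) (\<rho> z w))"
    and n: "n \<ge> 1"
  shows "\<rho> (x 0) (x n) \<le> 2 * (\<Sum>i<n. \<rho> (x i) (x (Suc i)))"
  using n
proof (induction n arbitrary: x rule: less_induct)
  case (less n)
  define s where "s m = (\<Sum>i<m. \<rho> (x i) (x (Suc i)))" for m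
  have s_pos: "0 < s n" unfolding s_def by (rule sum_pos2[of _ 0]) (use less.prems pos in \<open>auto intro: less_imp_le\<close>)
  define P where "P = {p. p < n \<and> s p \<le> s n / 2}"
  have "finite P" unfolding P_def by simp
  moreover have "0 \<in> P" using s_pos less.prems by (simp add: P_def s_def)
  ultimately have Max: "Max P \<in> P" "\<And>q. q \<in> P \<Longrightarrow> q \<le> Max P" by (auto intro: Max_in)
  define p where "p = Max P"
  have p: "p < n" "s p \<le> s n / 2" using Max(1) unfolding p_def P_def by auto
  have after: "s n / 2 < s (Suc p)" if "Suc p < n"
  proof (rule ccontr)
    assume "\<not> ?thesis"
    then have "Suc p \<in> P" using that unfolding P_def by simp
    then show False using Max(2) unfolding p_def by fastforce
  qed
  have left: "\<rho> (x 0) (x p) \<le> s n" if "p \<noteq> 0"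
    using less.IH[of p x] p that unfolding s_def by simp
  have mid: "\<rho> (x p) (x (Suc p)) \<le> s n"
    unfolding s_def by (rule member_le_sum) (use p pos in \<open>auto intro: less_imp_le\<close>)
  have right: "\<rho> (x (Suc p)) (x n) \<le> s n" if "Suc p < n"
  proof -
    define k where "k = n - Suc p"
    have k: "n = Suc p + k" "k < n" "1 \<le> k" using that unfolding k_def by auto
    have "\<rho> (x (Suc p)) (x n) \<le> 2 * (\<Sum>i<k. \<rho> (x (Suc p + i)) (x (Suc p + Suc i)))"
      using less.IH[of k "\<lambda>i. x (Suc p + i)"] k by simp
    also have "(\<Sum>i<k. \<rho> (x (Suc p + i)) (x (Suc p + Suc i))) = s n - s (Suc p)"
      unfolding s_def k(1) sum_lessThan_add[of _ "Suc p" k] by simp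
    finally show ?thesis using after[OF that] by simp
  qed
  consider "p = 0" "Suc p = n" | "p = 0" "Suc p < n" | "p \<noteq> 0" "Suc p = n" | "p \<noteq> 0" "Suc p < n"
    using p(1) by linarith
  then have "\<rho> (x 0) (x n) \<le> 2 * s n"
  proof cases
    case 1
    then show ?thesis using mid s_pos by simp
  next
    case 2
    then show ?thesis using two[of "x 0" "x n" "x (Suc p)"] mid right by simp
  next
    case 3
    then show ?thesis using two[of "x 0" "x n" "x p"] mid left by simp
  next
    case 4
    then show ?thesis using three[of "x 0" "x n" "x p" "x (Suc p)"] mid left right by simp
  qed
  then show ?case unfolding s_def .
qed

context hyperbolic_space
begin

text \<open>
  The visual quasi-metric. The exponent is chosen so that the loss \<open>2 * \<delta>\<close> of a twofold use of
  the four-point condition becomes the factor \<open>2\<close> in the hypotheses of the chain inequality.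
\<close>

definition visual_exponent :: real where
  "visual_exponent = ln 2 / (2 * \<delta>)"

definition visual :: "'a \<Rightarrow> 'a \<Rightarrow> real" where
  "visual x y = exp (- visual_exponent * Gromov_product a x y)"

lemma visual_exponent_pos: "visual_exponent > 0"
  using delta_pos by (simp add: visual_exponent_def)

lemma visual_pos: "0 < visual x y"
  by (simp add: visual_def)

lemma visual_commute: "visual x y = visual y x"
  by (simp add: visual_def Gromov_product_commute)

lemma visual_le_1: "visual x y \<le> 1"
  using visual_exponent_pos Gromov_product_nonneg[of a x y] by (simp add: visual_def)

lemma visual_le_exp: "R \<le> Gromov_product a x y \<Longrightarrow> visual x y \<le> exp (- visual_exponent * R)"
  using visual_exponent_pos by (simp add: visual_def)

lemma visual_ge_exp: "Gromov_product a x y \<le> R \<Longrightarrow> exp (- visual_exponent * R) \<le> visual x y"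
  using visual_exponent_pos by (simp add: visual_def)

lemma visual_lipschitz: "dist x y \<le> t \<Longrightarrow> visual x z \<le> exp (visual_exponent * t) * visual y z"
  using Gromov_product_lipschitz_left[of a y z x] visual_exponent_pos
    mult_left_mono[of "Gromov_product a y z" "Gromov_product a x z + t" visual_exponent]
  by (simp add: visual_def dist_commute algebra_simps flip: exp_add)

text \<open>
  As \<open>B\<close> may itself be a minimum of two Gromov products, this yields both weak triangle inequalities
  of the chain lemma.
\<close>

lemma visual_le_2_times:
  assumes "min A B - 2 * \<delta> \<le> Gromov_product a x y"
  shows "visual x y \<le> 2 * max (exp (- visual_exponent * A)) (exp (- visual_exponent * B))"
proof -
  have "exp (visual_exponent * (2 * \<delta>)) = 2"
    using delta_pos by (simp add: visual_exponent_def)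
  moreover have "visual x y \<le> exp (- visual_exponent * (min A B - 2 * \<delta>))"
    using assms by (rule visual_le_exp)
  moreover have "exp (- visual_exponent * (min A B - 2 * \<delta>)) =
      exp (visual_exponent * (2 * \<delta>)) * exp (- visual_exponent * min A B)"
    by (simp add: algebra_simps flip: exp_add)
  ultimately have "visual x y \<le> 2 * exp (- visual_exponent * min A B)" by simp
  moreover have "exp (- visual_exponent * min A B) \<le>
      max (exp (- visual_exponent * A)) (exp (- visual_exponent * B))"
    by (cases "A \<le> B") (simp_all add: min_def le_max_iff_disj)
  ultimately show ?thesis by linarith
qed

lemma visual_triangle: "visual x z \<le> 2 * max (visual x y) (visual y z)"
  using visual_le_2_times[of "Gromov_product a x y" "Gromov_product a y z" x z] hyperbolic[of a x y z]
    delta_pos by (simp add: visual_def)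

lemma visual_quadrangle: "visual x w \<le> 2 * max (visual x y) (max (visual y z) (visual z w))"
proof -
  have "min (Gromov_product a x y) (min (Gromov_product a y z) (Gromov_product a z w)) - 2 * \<delta>
      \<le> Gromov_product a x w"
    by (rule hyperbolic_trans2[of _ a x y z w]) auto
  from visual_le_2_times[OF this] have "visual x w \<le> 2 * max (visual x y)
      (exp (- visual_exponent * min (Gromov_product a y z) (Gromov_product a z w)))"
    by (simp add: visual_def)
  moreover have "exp (- visual_exponent * min (Gromov_product a y z) (Gromov_product a z w)) \<le>
      max (visual y z) (visual z w)"
    by (simp add: visual_def min_def le_max_iff_disj)
  ultimately show ?thesis by (smt (verit) max.mono)
qed

lemma visual_chain:
  "n \<ge> 1 \<Longrightarrow> visual (y 0) (y n) \<le> 2 * (\<Sum>i<n. visual (y i) (y (Suc i)))"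
  by (rule Frink_chain_inequality[OF visual_pos visual_triangle visual_quadrangle])

text \<open>
  The chain metric to a point \<open>p\<close>, made continuous: since \<open>visual x x > 0\<close>, the infimum over chains
  alone need not be continuous. Allowing a first step measured by the metric makes it Lipschitz and
  changes it only by a bounded factor.
\<close>

definition chain_costs :: "'a \<Rightarrow> 'a \<Rightarrow> real set" where
  "chain_costs p x = {dist x (y 0) + (\<Sum>i<n. visual (y i) (y (Suc i))) | y n. n \<ge> 1 \<and> y n = p}"

definition chain_distance :: "'a \<Rightarrow> 'a \<Rightarrow> real" where
  "chain_distance p x = Inf (chain_costs p x)"

lemma chain_costsI:
  "n \<ge> 1 \<Longrightarrow> y n = p \<Longrightarrow> dist x (y 0) + (\<Sum>i<n. visual (y i) (y (Suc i))) \<in> chain_costs p x"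
  unfolding chain_costs_def by blast

lemma chain_costsE:
  assumes "c \<in> chain_costs p x"
  obtains y n where "n \<ge> 1" "y n = p" "c = dist x (y 0) + (\<Sum>i<n. visual (y i) (y (Suc i)))"
  using assms unfolding chain_costs_def by auto

lemma visual_in_chain_costs: "visual x p \<in> chain_costs p x"
  using chain_costsI[of 1 "\<lambda>i. if i = 0 then x else p" p x] by simp

lemma chain_cost_nonneg: "c \<in> chain_costs p x \<Longrightarrow> 0 \<le> c"
  unfolding chain_costs_def by (auto intro!: add_nonneg_nonneg sum_nonneg less_imp_le[OF visual_pos])

lemma chain_distance_le: "c \<in> chain_costs p x \<Longrightarrow> chain_distance p x \<le> c"
  unfolding chain_distance_def by (rule cInf_lower) (auto intro: bdd_belowI chain_cost_nonneg)

lemma chain_distance_ge: "(\<And>c. c \<in> chain_costs p x \<Longrightarrow> b \<le> c) \<Longrightarrow> b \<le> chain_distance p x"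
  unfolding chain_distance_def by (rule cInf_greatest) (use visual_in_chain_costs in blast)+

lemma chain_distance_nonneg: "0 \<le> chain_distance p x"
  by (rule chain_distance_ge) (rule chain_cost_nonneg)

lemma chain_distance_le_visual: "chain_distance p x \<le> visual x p"
  by (rule chain_distance_le) (rule visual_in_chain_costs)

lemma chain_distance_le_1: "chain_distance p x \<le> 1"
  using chain_distance_le_visual[of p x] visual_le_1[of x p] by linarith

lemma chain_distance_lipschitz: "chain_distance p x \<le> chain_distance p x' + dist x x'"
proof -
  have "chain_distance p x - dist x x' \<le> c" if c: "c \<in> chain_costs p x'" for c
  proof -
    obtain y n where y: "n \<ge> 1" "y n = p" "c = dist x' (y 0) + (\<Sum>i<n. visual (y i) (y (Suc i)))"
      by (rule chain_costsE[OF c])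
    show ?thesis
      using chain_distance_le[OF chain_costsI[where n = n and y = y and x = x, OF y(1,2)]] y(3) dist_triangle[of x "y 0" x']
      by simp
  qed
  then have "chain_distance p x - dist x x' \<le> chain_distance p x'" by (rule chain_distance_ge)
  then show ?thesis by simp
qed

text \<open>
  This inequality is what gives continuity at infinity. Only chains which begin with a metric step of
  length at most \<open>1\<close> matter, because the chain distance never exceeds \<open>1\<close>; along such a step the
  visual quasi-metric changes by a bounded factor.
\<close>

lemma chain_distance_visual_lipschitz:
  "chain_distance p x \<le> chain_distance p x' + exp visual_exponent * visual x x'"
proof -
  have "chain_distance p x - exp visual_exponent * visual x x' \<le> c" if c: "c \<in> chain_costs p x'" for c
  proof -
    obtain y n where y: "n \<ge> 1" "y n = p" "c = dist x' (y 0) + (\<Sum>i<n. visual (y i) (y (Suc i)))"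
      by (rule chain_costsE[OF c])
    show ?thesis
    proof (cases "dist x' (y 0) \<le> 1")
      case True
      \<comment> \<open>put \<open>x\<close> in front of the chain; its first step then replaces the metric step from \<open>x'\<close>\<close>
      define y' where "y' i = (case i of 0 \<Rightarrow> x | Suc j \<Rightarrow> y j)" for i
      have "chain_distance p x \<le> dist x (y' 0) + (\<Sum>i<Suc n. visual (y' i) (y' (Suc i)))"
        by (rule chain_distance_le, rule chain_costsI) (simp_all add: y'_def y(2))
      also have "\<dots> = visual x (y 0) + (\<Sum>i<n. visual (y i) (y (Suc i)))"
        unfolding sum.lessThan_Suc_shift by (simp add: y'_def)
      also have "visual x (y 0) \<le> exp visual_exponent * visual x x'"
        using visual_lipschitz[of "y 0" x' 1 x] True by (simp add: visual_commute dist_commute)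
      finally show ?thesis using y(3) zero_le_dist[of x' "y 0"] by linarith
    next
      case False
      then have "1 \<le> c" using y(3) sum_nonneg[of "{..<n}" "\<lambda>i. visual (y i) (y (Suc i))"]
        by (simp add: less_imp_le[OF visual_pos])
      moreover have "0 < exp visual_exponent * visual x x'" using visual_pos by simp
      ultimately show ?thesis using chain_distance_le_1[of p x] by linarith
    qed
  qed
  then have "chain_distance p x - exp visual_exponent * visual x x' \<le> chain_distance p x'"
    by (rule chain_distance_ge)
  then show ?thesis by simp
qed

lemma visual_le_chain_distance: "exp (- visual_exponent) / 2 * visual x p \<le> chain_distance p x"
proof (rule chain_distance_ge)
  fix c assume c: "c \<in> chain_costs p x"
  obtain y n where y: "n \<ge> 1" "y n = p" "c = dist x (y 0) + (\<Sum>i<n. visual (y i) (y (Suc i)))"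
    by (rule chain_costsE[OF c])
  show "exp (- visual_exponent) / 2 * visual x p \<le> c"
  proof (cases "dist x (y 0) \<le> 1")
    case True
    have "exp (- visual_exponent) * visual x p \<le>
        exp (- visual_exponent) * (exp visual_exponent * visual (y 0) p)"
      using visual_lipschitz[OF True, of p] by (intro mult_left_mono) auto
    also have "\<dots> = visual (y 0) p"
      by (simp add: exp_minus)
    also have "\<dots> \<le> 2 * (\<Sum>i<n. visual (y i) (y (Suc i)))"
      using visual_chain[OF y(1), of y] y(2) by simp
    finally show ?thesis using y(3) zero_le_dist[of x "y 0"] by linarith
  next
    case False
    then have "1 \<le> c" using y(3) sum_nonneg[of "{..<n}" "\<lambda>i. visual (y i) (y (Suc i))"]
      by (simp add: less_imp_le[OF visual_pos])
    moreover have "exp (- visual_exponent) \<le> 1" using visual_exponent_pos by simp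
    then have "exp (- visual_exponent) / 2 * visual x p \<le> 1 * 1"
      using visual_le_1[of x p] visual_pos[of x p] by (intro mult_mono) linarith+
    ultimately show ?thesis by simp
  qed
qed

lemma chain_distance_in_C_QG: "(\<lambda>x. complex_of_real (chain_distance p x)) \<in> C_QG"
proof (rule C_QG_criterion)
  have "cmod (complex_of_real (chain_distance p x)) \<le> 1" for x
    using chain_distance_nonneg chain_distance_le_1 by simp
  then show "bounded (range (\<lambda>x. complex_of_real (chain_distance p x)))"
    unfolding bounded_iff by blast
  have "1-lipschitz_on UNIV (chain_distance p)"
  proof (rule lipschitz_onI)
    show "dist (chain_distance p x) (chain_distance p y) \<le> 1 * dist x y" for x y
      using chain_distance_lipschitz[of p x y] chain_distance_lipschitz[of p y x]
      by (simp add: dist_real_def dist_commute abs_le_iff)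
  qed simp
  then show "continuous_on UNIV (\<lambda>x. complex_of_real (chain_distance p x))"
    by (intro continuous_intros lipschitz_on_continuous_on)
  fix e :: real assume e: "e > 0"
  \<comment> \<open>the solution of \<open>exp visual_exponent * exp (- visual_exponent * R) = e / 2\<close>\<close>
  define R where "R = 1 - ln (e / 2) / visual_exponent"
  have "cmod (complex_of_real (chain_distance p x) - complex_of_real (chain_distance p y)) < e"
    if "R \<le> Gromov_product a x y" for x y
  proof -
    have "exp visual_exponent * visual x y \<le> exp visual_exponent * exp (- visual_exponent * R)"
      using visual_le_exp[OF that] by simp
    also have "\<dots> = exp (ln (e / 2))"
      unfolding R_def exp_add[symmetric] using visual_exponent_pos by (simp add: field_simps)
    also have "\<dots> = e / 2" using e by simp
    finally have "\<bar>chain_distance p x - chain_distance p y\<bar> \<le> e / 2"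
      using chain_distance_visual_lipschitz[of p x y] chain_distance_visual_lipschitz[of p y x]
      unfolding visual_commute[of y x] by linarith
    then show ?thesis using e by (simp flip: of_real_diff)
  qed
  then show "\<exists>R. \<forall>x y. R \<le> Gromov_product a x y \<longrightarrow>
      cmod (complex_of_real (chain_distance p x) - complex_of_real (chain_distance p y)) < e" by blast
qed

definition bump :: "'a \<Rightarrow> 'a \<Rightarrow> complex" where
  "bump x y = complex_of_real (max 0 (1 - dist x y))"

lemma bump_eq_0: "1 \<le> dist x y \<Longrightarrow> bump x y = 0"
  by (simp add: bump_def)

lemma bump_far: "dist x a + 1 \<le> dist y a \<Longrightarrow> bump x y = 0"
  using dist_triangle[of y a x] by (intro bump_eq_0) (simp add: dist_commute)

lemma bump_in_C_QG: "bump x \<in> C_QG"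
proof (rule C_QG_criterion)
  have "cmod (bump x y) \<le> 1" for y
    unfolding bump_def norm_of_real by (simp add: abs_le_iff)
  then show "bounded (range (bump x))"
    unfolding bounded_iff by blast
  show "continuous_on UNIV (bump x)"
    unfolding bump_def by (intro continuous_intros)
  fix e :: real assume "e > 0"
  then have "cmod (bump x y - bump x z) < e" if "dist x a + 1 \<le> Gromov_product a y z" for y z
    using that bump_far[of x y] bump_far[of x z]
      Gromov_product_le_dist_left[of a y z] Gromov_product_le_dist_right[of a y z] by simp
  then show "\<exists>R. \<forall>y z. R \<le> Gromov_product a y z \<longrightarrow> cmod (bump x y - bump x z) < e" by blast
qed

end

context proper_hyperbolic_space
begin

lemma extension_separates_points:
  assumes x: "z \<noteq> Inl x"  and z: "z \<in> Gromov_points a"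
  shows "\<exists>f\<in>C_QG. extension f (Inl x) \<noteq> extension f z"
proof (cases z)
  case (Inl y)
  then have "x \<noteq> y" using x by blast
  then have "max 0 (1 - dist x y) \<noteq> 1" by (auto simp: max_def)
  then have "bump x x \<noteq> bump x y" by (simp add: bump_def)
  then show ?thesis using bump_in_C_QG[of x] Inl by auto
next
  case (Inr \<xi>)
  then have \<xi>: "\<xi> \<in> Gromov_boundary a" using z by (auto simp: Gromov_points_def)
  obtain u where u: "u \<in> \<xi>" using boundary_nonempty[OF \<xi>] .
  obtain N where N: "\<And>m n. N \<le> m \<Longrightarrow> N \<le> n \<Longrightarrow> dist x a + 1 \<le> Gromov_product a (u m) (u n)"
    using Gromov_relD[OF boundary_rel[OF \<xi> u u]] by blast
  have "bump x (u n) = 0" if "N \<le> n" for n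
    using N[OF that that] Gromov_product_le_dist_left[of a "u n" "u n"] by (intro bump_far) simp
  then have "(\<lambda>n. bump x (u n)) \<longlonglongrightarrow> 0"
    by (intro tendsto_eventually) (auto simp: eventually_sequentially)
  then have "extension (bump x) z = 0"
    unfolding Inr by (rule extension_eqI[OF bump_in_C_QG \<xi> u])
  moreover have "extension (bump x) (Inl x) = 1" by (simp add: bump_def)
  ultimately show ?thesis using bump_in_C_QG[of x] by (intro bexI[of _ "bump x"]) simp_all
qed

text \<open>
  Inequivalent sequences \<open>u\<close> and \<open>v\<close> eventually have bounded Gromov products. So for \<open>p = v N\<close> with
  \<open>N\<close> large, the chain distance to \<open>p\<close> is bounded below along \<open>u\<close>, but as small as desired along \<open>v\<close>.
\<close>

lemma extension_separates_boundary:
  assumes \<xi>: "\<xi> \<in> Gromov_boundary a" and \<eta>: "\<eta> \<in> Gromov_boundary a" and ne: "\<xi> \<noteq> \<eta>"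
  shows "\<exists>f\<in>C_QG. extension f (Inr \<xi>) \<noteq> extension f (Inr \<eta>)"
proof -
  obtain u where u: "u \<in> \<xi>" using boundary_nonempty[OF \<xi>] .
  obtain v where v: "v \<in> \<eta>" using boundary_nonempty[OF \<eta>] .
  have "(u, v) \<notin> Gromov_rel a" using boundary_distinct_not_rel[OF \<xi> \<eta> ne u v] .
  then obtain S where S: "\<And>N. \<exists>m\<ge>N. \<exists>n\<ge>N. Gromov_product a (u m) (v n) < S"
    using boundary_sequence[OF \<xi> u] boundary_sequence[OF \<eta> v] unfolding Gromov_rel_iff
    by (meson not_le)
  \<comment> \<open>the lower bound along \<open>u\<close>, from \<open>visual_le_chain_distance\<close>; \<open>T\<close> makes the distance along \<open>v\<close>
    at most \<open>B / 2\<close>\<close>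
  define B where "B = exp (- visual_exponent) / 2 * exp (- visual_exponent * (S + 2 * \<delta>))"
  have B: "B > 0" by (simp add: B_def)
  define T where "T = - ln (B / 2) / visual_exponent"
  obtain N where N: "\<And>m n. N \<le> m \<Longrightarrow> N \<le> n \<Longrightarrow> S + 2 * \<delta> \<le> Gromov_product a (u m) (u n)"
    using Gromov_relD[OF boundary_rel[OF \<xi> u u]] by blast
  obtain M where M: "\<And>m n. M \<le> m \<Longrightarrow> M \<le> n \<Longrightarrow> max T (S + 2 * \<delta>) \<le> Gromov_product a (v m) (v n)"
    using Gromov_relD[OF boundary_rel[OF \<eta> v v]] by blast
  define p where "p = v (max M N)"
  have le: "Gromov_product a (u n) p \<le> S + 2 * \<delta>" if "N \<le> n" for n
  proof (rule ccontr)
    assume "\<not> ?thesis"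
    then have gt: "S + 2 * \<delta> \<le> Gromov_product a (u n) p" by simp
    obtain i j where ij: "max M N \<le> i" "max M N \<le> j" "Gromov_product a (u i) (v j) < S"
      using S by blast
    have "S + 2 * \<delta> - 2 * \<delta> \<le> Gromov_product a (u i) (v j)"
      by (rule hyperbolic_trans2[of _ _ _ "u n" p])
        (use N[of i n] M[of "max M N" j] gt that ij in \<open>auto simp: p_def\<close>)
    then show False using ij(3) by simp
  qed
  define f where "f x = complex_of_real (chain_distance p x)" for x
  have f: "f \<in> C_QG" unfolding f_def by (rule chain_distance_in_C_QG)
  have norm_f: "cmod (f x) = chain_distance p x" for x
    using chain_distance_nonneg by (simp add: f_def)
  have "B \<le> cmod (f (u n))" if "N \<le> n" for n
  proof -
    have "B \<le> exp (- visual_exponent) / 2 * visual (u n) p"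
      unfolding B_def using visual_ge_exp[OF le[OF that]] by (intro mult_left_mono) auto
    then show ?thesis using visual_le_chain_distance[of "u n" p] norm_f by simp
  qed
  then have "B \<le> cmod (extension f (Inr \<xi>))"
    by (intro tendsto_lowerbound[OF tendsto_norm[OF extension_tendsto[OF f \<xi> u]]])
      (auto simp: eventually_sequentially)
  moreover have "cmod (f (v n)) \<le> B / 2" if "M \<le> n" for n
  proof -
    have "chain_distance p (v n) \<le> exp (- visual_exponent * T)"
      using chain_distance_le_visual[of p "v n"] visual_le_exp[of T "v n" p] M[of n "max M N"] that
      by (simp add: p_def)
    also have "\<dots> = B / 2" using B visual_exponent_pos by (simp add: T_def)
    finally show ?thesis using norm_f by simp
  qed
  then have "cmod (extension f (Inr \<eta>)) \<le> B / 2"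
    by (intro tendsto_upperbound[OF tendsto_norm[OF extension_tendsto[OF f \<eta> v]]])
      (auto simp: eventually_sequentially)
  ultimately have "extension f (Inr \<xi>) \<noteq> extension f (Inr \<eta>)" using B by auto
  then show ?thesis using f by blast
qed

end

section \<open>Characters are evaluations\<close>

lemma topspace_QG_compactification: "topspace QG_compactification = characters C_QG"
  unfolding QG_compactification_def maximal_ideal_space_def
  by (auto simp: characters_def PiE_def)

lemma Hausdorff_space_QG_compactification: "Hausdorff_space QG_compactification"
  unfolding QG_compactification_def maximal_ideal_space_def
  by (simp add: Hausdorff_space_subtopology Hausdorff_space_product_topology)

context proper_hyperbolic_space
begin

definition evaluation :: "'a Gromov_point \<Rightarrow> (('a \<Rightarrow> complex) \<Rightarrow> complex)" where
  "evaluation z = (\<lambda>f\<in>C_QG. extension f z)"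

lemma evaluation_Inl: "evaluation (Inl x) = QG_embedding x"
  by (simp add: evaluation_def QG_embedding_def)

lemma representing_sequence_exists:
  assumes "z \<in> Gromov_points a"
  obtains u where "u \<in> representing_sequences z"
proof (cases z)
  case (Inl x)
  then show ?thesis using that[of "\<lambda>_. x"] by simp
next
  case (Inr \<xi>)
  then show ?thesis using assms boundary_nonempty that by (auto simp: Gromov_points_def)
qed

lemma evaluation_in_characters:
  assumes z: "z \<in> Gromov_points a"
  shows "evaluation z \<in> characters C_QG"
proof -
  obtain u where u: "u \<in> representing_sequences z" using representing_sequence_exists[OF z] .
  note lim = extension_tendsto_representing[OF _ z u]
  have add: "extension (\<lambda>x. f x + g x) z = extension f z + extension g z"
    if "f \<in> C_QG" "g \<in> C_QG" for f g
    using LIMSEQ_unique[OF lim[OF C_QG_add[OF that]] tendsto_add[OF lim[OF that(1)] lim[OF that(2)]]] .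
  have mult: "extension (\<lambda>x. f x * g x) z = extension f z * extension g z"
    if "f \<in> C_QG" "g \<in> C_QG" for f g
    using LIMSEQ_unique[OF lim[OF C_QG_mult[OF that]] tendsto_mult[OF lim[OF that(1)] lim[OF that(2)]]] .
  have const: "extension (\<lambda>_. c) z = c" for c
    using LIMSEQ_unique[OF lim[OF C_QG_const] tendsto_const] .
  have "\<exists>f\<in>C_QG. evaluation z f \<noteq> 0"
    using const[of 1] by (intro bexI[of _ "\<lambda>_. 1"]) (simp_all add: evaluation_def C_QG_const)
  then show ?thesis
    unfolding characters_def
    using add mult[OF C_QG_const] mult const
    by (simp add: evaluation_def C_QG_add C_QG_mult C_QG_const C_QG_mult[OF C_QG_const])
qed

lemma continuous_map_evaluation: "continuous_map (Gromov_compactification a) QG_compactification evaluation"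
  unfolding QG_compactification_def maximal_ideal_space_def continuous_map_in_subtopology
proof
  show "continuous_map (Gromov_compactification a) (product_topology (\<lambda>_. euclidean) C_QG) evaluation"
    unfolding continuous_map_componentwise
    using continuous_map_extension by (auto simp: evaluation_def)
  show "evaluation \<in> topspace (Gromov_compactification a) \<rightarrow> characters C_QG"
    using evaluation_in_characters by (simp add: topspace_Gromov_compactification)
qed

lemma inj_on_evaluation: "inj_on evaluation (Gromov_points a)"
proof (rule inj_onI)
  fix z w assume z: "z \<in> Gromov_points a" and w: "w \<in> Gromov_points a"
    and eq: "evaluation z = evaluation w"
  have ext: "extension f z = extension f w" if "f \<in> C_QG" for f
    using fun_cong[OF eq, of f] that by (simp add: evaluation_def)
  show "z = w"
  proof (cases z)
    case (Inl x)
    then show ?thesis using extension_separates_points[OF _ w, of x] ext by metis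
  next
    case (Inr \<xi>)
    show ?thesis
    proof (cases w)
      case (Inl y)
      then show ?thesis using extension_separates_points[OF _ z, of y] ext by metis
    next
      case w': (Inr \<eta>)
      have "\<xi> \<in> Gromov_boundary a" "\<eta> \<in> Gromov_boundary a"
        using z w Inr w' by (auto simp: Gromov_points_def)
      then show ?thesis using extension_separates_boundary ext Inr w' by metis
    qed
  qed
qed

text \<open>
  The classical argument that a compact space is the character space of its functions, but carried
  out inside the algebra. If the kernel of \<open>\<phi>\<close> had no common zero, then compactness would give
  finitely many members \<open>f\<close> of the kernel with \<open>\<Sum> f * cnj f \<ge> 1\<close> on the whole space. This sum
  lies in the kernel and is invertible in the algebra, which is impossible.
\<close>

lemma character_is_evaluation:
  assumes \<phi>: "\<phi> \<in> characters C_QG"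
  shows "\<exists>z\<in>Gromov_points a. \<phi> = evaluation z"
proof -
  have ext: "\<phi> \<in> extensional C_QG"
    and add: "\<And>f g. f \<in> C_QG \<Longrightarrow> g \<in> C_QG \<Longrightarrow> \<phi> (\<lambda>x. f x + g x) = \<phi> f + \<phi> g"
    and scale: "\<And>c f. f \<in> C_QG \<Longrightarrow> \<phi> (\<lambda>x. c * f x) = c * \<phi> f"
    and mult: "\<And>f g. f \<in> C_QG \<Longrightarrow> g \<in> C_QG \<Longrightarrow> \<phi> (\<lambda>x. f x * g x) = \<phi> f * \<phi> g"
    using \<phi> unfolding characters_def by auto
  obtain f1 where "f1 \<in> C_QG" "\<phi> f1 \<noteq> 0" using \<phi> unfolding characters_def by auto
  then have one: "\<phi> (\<lambda>_. 1) = 1" using mult[OF _ C_QG_const, of f1 1] by simp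
  have const: "\<phi> (\<lambda>_. c) = c" for c
    using scale[OF C_QG_const, of c 1] one by simp
  have "\<exists>z\<in>Gromov_points a. \<forall>f\<in>C_QG. \<phi> f = 0 \<longrightarrow> extension f z = 0"
  proof (rule ccontr)
    assume contra: "\<not> ?thesis"
    have "\<exists>f\<in>C_QG. \<phi> f = 0 \<and> cmod (extension f z) > 1" if z: "z \<in> Gromov_points a" for z
    proof -
      obtain f where f: "f \<in> C_QG" "\<phi> f = 0" "extension f z \<noteq> 0" using contra z by blast
      \<comment> \<open>scaled to the value \<open>2\<close> at \<open>z\<close>, so that the modulus exceeds \<open>1\<close> near \<open>z\<close>\<close>
      define c where "c = 2 / extension f z"
      have cf: "(\<lambda>x. c * f x) \<in> C_QG" by (rule C_QG_mult[OF C_QG_const f(1)])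
      obtain u where u: "u \<in> representing_sequences z" using representing_sequence_exists[OF z] .
      note lim = extension_tendsto_representing[OF _ z u]
      have "extension (\<lambda>x. c * f x) z = c * extension f z"
        using LIMSEQ_unique[OF lim[OF cf] tendsto_mult[OF tendsto_const lim[OF f(1)]]] .
      then have "extension (\<lambda>x. c * f x) z = 2" using f(3) by (simp add: c_def)
      moreover have "\<phi> (\<lambda>x. c * f x) = 0" using scale[OF f(1)] f(2) by simp
      ultimately show ?thesis using cf by force
    qed
    then obtain F where F: "\<And>z. z \<in> Gromov_points a \<Longrightarrow> F z \<in> C_QG"
      "\<And>z. z \<in> Gromov_points a \<Longrightarrow> \<phi> (F z) = 0"
      "\<And>z. z \<in> Gromov_points a \<Longrightarrow> cmod (extension (F z) z) > 1" by metis
    define V where "V z = {w \<in> topspace (Gromov_compactification a). extension (F z) w \<in> - cball 0 1}" for z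
    have "openin (Gromov_compactification a) (V z)" if "z \<in> Gromov_points a" for z
      unfolding V_def
      by (rule openin_continuous_map_preimage[OF continuous_map_extension[OF F(1)[OF that]]])
        (simp add: open_Compl)
    moreover have "topspace (Gromov_compactification a) \<subseteq> \<Union>(V ` Gromov_points a)"
      unfolding V_def topspace_Gromov_compactification using F(3) by (fastforce simp: not_le)
    ultimately obtain \<F> where "finite \<F>" "\<F> \<subseteq> V ` Gromov_points a"
      "topspace (Gromov_compactification a) \<subseteq> \<Union>\<F>"
      using compact_space_Gromov_compactification unfolding compact_space_alt
      by (metis (no_types, lifting) imageE)
    then obtain Z where Z: "finite Z" "Z \<subseteq> Gromov_points a"
      "Gromov_points a \<subseteq> \<Union>(V ` Z)"
      unfolding topspace_Gromov_compactification by (metis finite_subset_image)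
    define s where "s Y x = (\<Sum>z\<in>Y. F z x * cnj (F z x))" for Y x
    have s: "s Y \<in> C_QG \<and> \<phi> (s Y) = 0" if "Y \<subseteq> Z" for Y
    proof -
      have "finite Y" using that Z(1) finite_subset by blast
      then show ?thesis using that
      proof induction
        case empty
        then show ?case using C_QG_const[of 0] const[of 0] by (simp add: s_def[abs_def])
      next
        case (insert z Y)
        then have z: "z \<in> Gromov_points a" using Z(2) by blast
        have sq: "(\<lambda>x. F z x * cnj (F z x)) \<in> C_QG"
          by (intro C_QG_mult C_QG_cnj F z)
        have "\<phi> (\<lambda>x. F z x * cnj (F z x)) = 0"
          using mult[OF F(1)[OF z] C_QG_cnj[OF F(1)[OF z]]] F(2)[OF z] by simp
        moreover have "s (insert z Y) = (\<lambda>x. F z x * cnj (F z x) + s Y x)"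
          unfolding s_def[abs_def] using insert.hyps by simp
        ultimately show ?case
          using insert.IH insert.prems add[OF sq, of "s Y"] C_QG_add[OF sq, of "s Y"] by simp
      qed
    qed
    have ge: "1 \<le> cmod (s Z x)" for x
    proof -
      have "Inl x \<in> Gromov_points a" by (simp add: Gromov_points_def)
      then obtain z where z: "z \<in> Z" "1 < cmod (F z x)" using Z(3) by (auto simp: V_def)
      have "1 \<le> (cmod (F z x))\<^sup>2" using z(2) by simp
      also have "\<dots> \<le> (\<Sum>z\<in>Z. (cmod (F z x))\<^sup>2)"
        by (rule member_le_sum) (use z Z(1) in auto)
      also have "\<dots> = cmod (complex_of_real (\<Sum>z\<in>Z. (cmod (F z x))\<^sup>2))"
        by (simp add: sum_nonneg del: of_real_sum)
      also have "complex_of_real (\<Sum>z\<in>Z. (cmod (F z x))\<^sup>2) = s Z x"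
        by (simp add: s_def complex_norm_square del: of_real_power)
      finally show ?thesis .
    qed
    have "s Z x * inverse (s Z x) = 1" for x using ge[of x] by (auto intro!: right_inverse)
    moreover have "\<phi> (\<lambda>x. s Z x * inverse (s Z x)) = 0"
      using mult[OF _ C_QG_inverse[OF _ ge]] s[of Z] by simp
    ultimately show False using one by simp
  qed
  then obtain z where z: "z \<in> Gromov_points a" and ker: "\<And>f. f \<in> C_QG \<Longrightarrow> \<phi> f = 0 \<Longrightarrow> extension f z = 0"
    by blast
  have "\<phi> f = extension f z" if f: "f \<in> C_QG" for f
  proof -
    have f': "(\<lambda>x. f x + - \<phi> f) \<in> C_QG" by (rule C_QG_add[OF f C_QG_const])
    have "\<phi> (\<lambda>x. f x + - \<phi> f) = 0" using add[OF f C_QG_const, of "- \<phi> f"] const by simp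
    then have 0: "extension (\<lambda>x. f x + - \<phi> f) z = 0" using ker f' by blast
    obtain u where u: "u \<in> representing_sequences z" using representing_sequence_exists[OF z] .
    note lim = extension_tendsto_representing[OF _ z u]
    have "extension (\<lambda>x. f x + - \<phi> f) z = extension f z + - \<phi> f"
      using LIMSEQ_unique[OF lim[OF f'] tendsto_add[OF lim[OF f] tendsto_const]] .
    with 0 show ?thesis by simp
  qed
  then have "\<phi> = evaluation z"
    using ext by (intro extensionalityI[of _ C_QG]) (auto simp: evaluation_def)
  with z show ?thesis by blast
qed

lemma homeomorphic_map_evaluation:
  "homeomorphic_map (Gromov_compactification a) QG_compactification evaluation"
proof (rule continuous_imp_homeomorphic_map)
  show "evaluation ` topspace (Gromov_compactification a) = topspace QG_compactification"
    unfolding topspace_Gromov_compactification topspace_QG_compactification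
    using evaluation_in_characters character_is_evaluation by blast
  show "inj_on evaluation (topspace (Gromov_compactification a))"
    unfolding topspace_Gromov_compactification by (rule inj_on_evaluation)
qed (fact continuous_map_evaluation compact_space_Gromov_compactification
      Hausdorff_space_QG_compactification)+

lemma evaluation_boundary: "evaluation ` (Inr ` Gromov_boundary a) = QG_boundary"
proof -
  have "topspace QG_compactification = evaluation ` Gromov_points a"
    using homeomorphic_imp_surjective_map[OF homeomorphic_map_evaluation]
    by (simp add: topspace_Gromov_compactification)
  then have "QG_boundary = evaluation ` Gromov_points a - evaluation ` range Inl"
    unfolding QG_boundary_def by (simp add: image_image evaluation_Inl)
  also have "\<dots> = evaluation ` (Gromov_points a - range Inl)"
    by (rule inj_on_image_set_diff[OF inj_on_evaluation, symmetric]) (auto simp: Gromov_points_def)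
  also have "Gromov_points a - range Inl = Inr ` Gromov_boundary a"
    by (auto simp: Gromov_points_def)
  finally show ?thesis ..
qed

end

theorem proposition4p14:
  fixes a :: "'a::metric_space"
  assumes "proper_space TYPE('a)"
    and "geodesic_space TYPE('a)"
    and "Gromov_hyperbolic TYPE('a)"
  shows "\<exists>\<Phi>. homeomorphic_map (Gromov_compactification a) QG_compactification \<Phi> \<and>
             (\<forall>x::'a. \<Phi> (Inl x) = QG_embedding x) \<and>
             \<Phi> ` (Inr ` Gromov_boundary a) = QG_boundary"
proof -
  obtain \<delta> :: real where \<delta>: "\<delta> > 0" and hyp: "\<forall>x y z b::'a. Gromov_product b x y \<ge>
      min (Gromov_product b x z) (Gromov_product b z y) - \<delta> / 4"
    using assms(3) unfolding Gromov_hyperbolic_def by blast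
  interpret proper_hyperbolic_space a "\<delta> / 4"
    by unfold_locales (use assms(1,2) \<delta> hyp in auto)
  show ?thesis
    using homeomorphic_map_evaluation evaluation_Inl evaluation_boundary by blast
qed

end
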